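(* Say that a binary $[16,k]$ code $C$ is admissible if (i) there is an integer $a$ with $0<a<8$ such that $\{i\in\{0,1,\ldots,16\}\mid A_i(C)\ne 0\}=\{0,\,8-a,\,8,\,8+a,\,16\}$, and (ii) $C$ contains the first order Reed--Muller code $RM(1,4)$ as a subcode. If there exists an admissible $[16,k]$ code, then $k\in\{6,7,8\}$. Moreover, for each $k\in\{6,7,8\}$ there exist, up to equivalence, exactly two admissible $[16,k]$ codes.
   Context: A binary $[n,k]$ code is a $k$-dimensional vector subspace of $\mathbb{F}_2^n$. The weight of a vector is its number of non-zero coordinates, and $A_i(C)$ denotes the number of codewords of weight $i$ in $C$. Two codes of the same length are equivalent if one can be obtained from the other by permuting the coordinates. The first order Reed--Muller codes $RM(1,m)\subset\mathbb{F}_2^{2^m}$ are defined recursively by $RM(1,1)=\mathbb{F}_2^2$ and, for $m>1$, $RM(1,m)=\{(u,u),(u,u+\mathbf{1})\in\mathbb{F}_2^{2^m}\mid u\in RM(1,m-1)\}$, where $\mathbf{1}$ denotes the all-one vector of suitable length. *)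

theory Defs
  imports
    "HOL-Library.Z2"
    "HOL-Combinatorics.Permutations"
    "Jordan_Normal_Form.VS_Connect"
begin

definition binary_code :: "nat \<Rightarrow> nat \<Rightarrow> bit vec set \<Rightarrow> bool" where
  "binary_code n k C \<longleftrightarrow>
     VectorSpace.subspace class_ring C (module_vec TYPE(bit) n) \<and>
     vectorspace.dim class_ring (module_vec TYPE(bit) n\<lparr>carrier := C\<rparr>) = k"

definition weight :: "bit vec \<Rightarrow> nat" where
  "weight v = card {i. i < dim_vec v \<and> v $ i \<noteq> 0}"

definition weight_dist :: "bit vec set \<Rightarrow> nat \<Rightarrow> nat" where
  "weight_dist C i = card {c \<in> C. weight c = i}"

definition ones_vec :: "nat \<Rightarrow> bit vec" where
  "ones_vec n = vec n (\<lambda>_. 1)"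

text \<open>The first order Reed--Muller code \<open>RM(1,m)\<close>. The recursion starts at \<open>m = 1\<close>; the value
  at \<open>m = 0\<close> is only there for totality (it is the usual \<open>RM(1,0)\<close>, from which the recursive
  step would also yield \<open>RM(1,1)\<close>).\<close>

fun reed_muller1 :: "nat \<Rightarrow> bit vec set" where
  "reed_muller1 0 = carrier_vec 1"
| "reed_muller1 (Suc 0) = carrier_vec 2"
| "reed_muller1 (Suc (Suc m)) =
     {u @\<^sub>v u | u. u \<in> reed_muller1 (Suc m)} \<union>
     {u @\<^sub>v (u + ones_vec (2 ^ Suc m)) | u. u \<in> reed_muller1 (Suc m)}"

definition permute_vec :: "(nat \<Rightarrow> nat) \<Rightarrow> 'a vec \<Rightarrow> 'a vec" where
  "permute_vec p v = vec (dim_vec v) (\<lambda>i. v $ p i)"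

definition code_equivalent :: "nat \<Rightarrow> bit vec set \<Rightarrow> bit vec set \<Rightarrow> bool" where
  "code_equivalent n C D \<longleftrightarrow>
     C \<subseteq> carrier_vec n \<and> D \<subseteq> carrier_vec n \<and>
     (\<exists>p. p permutes {..<n} \<and> D = permute_vec p ` C)"

definition admissible :: "nat \<Rightarrow> bit vec set \<Rightarrow> bool" where
  "admissible k C \<longleftrightarrow>
     binary_code 16 k C \<and>
     (\<exists>a::nat. 0 < a \<and> a < 8 \<and>
        {i \<in> {0..16}. weight_dist C i \<noteq> 0} = {0, 8 - a, 8, 8 + a, 16}) \<and>
     reed_muller1 4 \<subseteq> C"

definition admissible_equivalence :: "nat \<Rightarrow> (bit vec set \<times> bit vec set) set" where
  "admissible_equivalence k =
     {(C, D). admissible k C \<and> admissible k D \<and> code_equivalent 16 C D}"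

lemma permute_vec_id: "permute_vec id v = v"
  by (auto simp: permute_vec_def)

lemma permute_vec_comp:
  assumes "v \<in> carrier_vec n" and "q permutes {..<n}"
  shows "permute_vec q (permute_vec p v) = permute_vec (p \<circ> q) v"
proof (rule eq_vecI)
  fix i assume "i < dim_vec (permute_vec (p \<circ> q) v)"
  then have "i < n" using assms(1) by (simp add: permute_vec_def)
  then have "q i < n" using permutes_in_image[OF assms(2), of i] by simp
  with \<open>i < n\<close> assms(1)
  show "permute_vec q (permute_vec p v) $ i = permute_vec (p \<circ> q) v $ i"
    by (simp add: permute_vec_def)
qed (simp add: permute_vec_def)

lemma code_equivalent_refl: "C \<subseteq> carrier_vec n \<Longrightarrow> code_equivalent n C C"
  unfolding code_equivalent_def
  by (auto intro!: exI[of _ id] simp: permutes_id permute_vec_id[abs_def] permute_vec_id)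

lemma code_equivalent_sym:
  assumes "code_equivalent n C D"
  shows "code_equivalent n D C"
proof -
  from assms obtain p where C: "C \<subseteq> carrier_vec n" and D: "D \<subseteq> carrier_vec n"
    and p: "p permutes {..<n}" and DC: "D = permute_vec p ` C"
    unfolding code_equivalent_def by blast
  have "permute_vec (inv_into UNIV p) (permute_vec p v) = v" if "v \<in> C" for v
    using that C permute_vec_comp[of v n "inv_into UNIV p" p] permutes_inv[OF p]
    by (auto simp: permutes_inv_o[OF p] permute_vec_id)
  then have "C = permute_vec (inv_into UNIV p) ` D" unfolding DC by (force simp: image_image)
  with C D permutes_inv[OF p] show ?thesis unfolding code_equivalent_def by blast
qed

lemma code_equivalent_trans:
  assumes "code_equivalent n C D" and "code_equivalent n D E"
  shows "code_equivalent n C E"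
proof -
  from assms obtain p q where C: "C \<subseteq> carrier_vec n" and E: "E \<subseteq> carrier_vec n"
    and p: "p permutes {..<n}" and q: "q permutes {..<n}"
    and DC: "D = permute_vec p ` C" and ED: "E = permute_vec q ` D"
    unfolding code_equivalent_def by blast
  have "permute_vec q (permute_vec p v) = permute_vec (p \<circ> q) v" if "v \<in> C" for v
    using permute_vec_comp[OF _ q] that C by blast
  then have "E = permute_vec (p \<circ> q) ` C" unfolding ED DC by (simp add: image_image)
  with C E permutes_compose[OF q p] show ?thesis unfolding code_equivalent_def by blast
qed

lemma binary_code_subset: "binary_code n k C \<Longrightarrow> C \<subseteq> carrier_vec n"
  unfolding binary_code_def VectorSpace.subspace_def
  by (auto dest!: submodule.subset simp: module_vec_simps)

lemma equiv_admissible_equivalence: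
  "equiv {C. admissible k C} (admissible_equivalence k)"
proof (rule equivI)
  show "admissible_equivalence k \<subseteq> {C. admissible k C} \<times> {C. admissible k C}"
    by (auto simp: admissible_equivalence_def)
  show "refl_on {C. admissible k C} (admissible_equivalence k)"
    by (auto simp: refl_on_def admissible_equivalence_def admissible_def
        intro!: code_equivalent_refl dest: binary_code_subset)
  show "sym (admissible_equivalence k)"
    by (auto simp: sym_def admissible_equivalence_def intro: code_equivalent_sym)
  show "trans (admissible_equivalence k)"
    by (auto simp: trans_def admissible_equivalence_def intro: code_equivalent_trans)
qed

end

theory Submission
  imports Defs "HOL-Library.Product_Plus"
begin

text \<open>
  View the words of length 16 as Boolean functions of four variables, so that \<open>RM(1,4)\<close> consists of
  the affine functions. For a codeword \<open>f\<close> outside \<open>RM(1,4)\<close> all weights on the coset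
  \<open>f + RM(1,4)\<close> lie in \<open>{8 - a, 8, 8 + a}\<close>; Parseval's identity (the squared deviations from 8 sum to
  128 over the 32 words of the coset) leaves \<open>a = 2\<close> with no weight 8, or \<open>a = 4\<close>. In both cases the
  weights on the coset are congruent modulo 4, so \<open>f\<close> is orthogonal to \<open>RM(1,4)\<close>, that is, quadratic.
  Hence the code is determined by a space \<open>U\<close> of alternating forms on \<open>F\<^sub>2\<^sup>4\<close>, identified with
  \<open>F\<^sub>2\<^sup>6\<close>, on which the Pfaffian vanishes (\<open>a = 4\<close>) or is nonzero away from 0 (\<open>a = 2\<close>).
  Transvections, acting by coordinate permutations, bring \<open>U\<close> into one of six normal forms: the totally
  singular subspaces of the Klein quadric (dimensions 1, 2 and two classes in dimension 3) and the
  anisotropic ones (dimensions 1 and 2). The weight 4 separates the two types; for the two classes of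
  dimension 3 the codes differ in whether the words of weight 4 separate all pairs of coordinates.
\<close>

text \<open>The default simp rules rewrite field operations on \<^typ>\<open>bit\<close> to bitwise ones, which hides
  the ring structure.\<close>

declare add_bit_eq_xor [simp del] mult_bit_eq_and [simp del]
declare One_nat_def [simp del]
declare split_paired_Ex [simp del] split_paired_All [simp del]

section \<open>Linear codes over the field with two elements\<close>

text \<open>Coordinates with respect to a finite basis are unique, so vectors correspond bijectively
  to the extensional coefficient functions on that basis.\<close>

lemma (in vectorspace) card_carrier_eq_power_dim:
  assumes "finite (carrier K)" and "fin_dim"
  shows "card (carrier V) = card (carrier K) ^ dim"
proof -
  obtain B where fin: "finite B" and B: "basis B"
    using finite_basis_exists[OF assms(2)] by blast
  then have BV: "B \<subseteq> carrier V" by (simp add: basis_def)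
  have uniq: "\<forall>v\<in>carrier V. \<exists>!a. a \<in> B \<rightarrow>\<^sub>E carrier K \<and> lincomb a B = v"
    using basis_criterion[OF fin BV] B by blast
  have "bij_betw (\<lambda>a. lincomb a B) (B \<rightarrow>\<^sub>E carrier K) (carrier V)"
    unfolding bij_betw_def
  proof
    have cl: "lincomb a B \<in> carrier V" if "a \<in> B \<rightarrow>\<^sub>E carrier K" for a
      using that BV by (intro lincomb_closed) auto
    show "inj_on (\<lambda>a. lincomb a B) (B \<rightarrow>\<^sub>E carrier K)"
      using uniq cl by (auto simp: inj_on_def)
    show "(\<lambda>a. lincomb a B) ` (B \<rightarrow>\<^sub>E carrier K) = carrier V"
      using uniq cl by blast
  qed
  then have "card (carrier V) = card (B \<rightarrow>\<^sub>E carrier K)"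
    by (simp add: bij_betw_same_card)
  then show ?thesis using fin dim_basis[OF fin B] by (simp add: card_funcsetE)
qed

lemma vectorspace_module_vec: "vectorspace class_ring (module_vec TYPE('a::field) n)"
proof -
  interpret vec_space "TYPE('a)" n .
  show ?thesis by (rule vectorspace_axioms)
qed

lemma UNIV_bit: "(UNIV :: bit set) = {0, 1}"
proof -
  have "x \<in> {0, 1}" for x :: bit by (cases x) simp_all
  then show ?thesis by blast
qed

lemma card_UNIV_bit: "card (UNIV :: bit set) = 2"
  by (simp add: UNIV_bit)

lemma finite_UNIV_bit [simp]: "finite (UNIV :: bit set)"
  by (simp add: UNIV_bit)

lemma finite_carrier_vec_bit: "finite (carrier_vec n :: bit vec set)"
proof -
  have "carrier_vec n \<subseteq> (\<lambda>f. vec n f) ` ({..<n} \<rightarrow>\<^sub>E (UNIV :: bit set))"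
  proof
    fix v :: "bit vec" assume "v \<in> carrier_vec n"
    then have "v = vec n (restrict (\<lambda>i. v $ i) {..<n})" by auto
    then show "v \<in> (\<lambda>f. vec n f) ` ({..<n} \<rightarrow>\<^sub>E UNIV)" 
      by (intro image_eqI[where x = "restrict (\<lambda>i. v $ i) {..<n}"]) auto
  qed
  then show ?thesis by (rule finite_subset) (simp add: finite_PiE)
qed

text \<open>The only scalars are 0 and 1, so closure under scalar multiples comes from the zero
  vector lying in \<open>C\<close>.\<close>

lemma subspace_bit_iff:
  "VectorSpace.subspace class_ring C (module_vec TYPE(bit) n) \<longleftrightarrow>
     C \<subseteq> carrier_vec n \<and> 0\<^sub>v n \<in> C \<and> (\<forall>u\<in>C. \<forall>v\<in>C. u + v \<in> C)"
proof -
  interpret vectorspace class_ring "module_vec TYPE(bit) n" by (rule vectorspace_module_vec)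
  have "c \<cdot>\<^sub>v v \<in> C" if "C \<subseteq> carrier_vec n" "0\<^sub>v n \<in> C" "v \<in> C" for c :: bit and v
  proof (cases c)
    case zero
    moreover have "v \<in> carrier_vec n" using that by blast
    then have "0 \<cdot>\<^sub>v v = 0\<^sub>v n" by auto
    ultimately show ?thesis using that by simp
  next
    case one
    then show ?thesis using that by simp
  qed
  moreover have "Module.module class_ring (module_vec TYPE(bit) n)" 
    using vectorspace_axioms unfolding vectorspace_def by blast
  ultimately show ?thesis
    unfolding VectorSpace.subspace_def submodule_def module_vec_simps
    using vectorspace_axioms by auto
qed

text \<open>Over a field with two elements the cardinality determines the dimension. From here on
  dimensions are handled by counting words.\<close>

lemma binary_code_iff:
  "binary_code n k C \<longleftrightarrow>
     C \<subseteq> carrier_vec n \<and> 0\<^sub>v n \<in> C \<and> (\<forall>u\<in>C. \<forall>v\<in>C. u + v \<in> C) \<and> card C = 2 ^ k"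
proof -
  have "card C = 2 ^ vectorspace.dim class_ring (module_vec TYPE(bit) n\<lparr>carrier := C\<rparr>)"
    if sub: "VectorSpace.subspace class_ring C (module_vec TYPE(bit) n)"
  proof -
    interpret W: vectorspace class_ring "module_vec TYPE(bit) n\<lparr>carrier := C\<rparr>"
      by (rule vectorspace.subspace_is_vs[OF vectorspace_module_vec sub])
    have "finite C"
      using sub finite_carrier_vec_bit unfolding subspace_bit_iff by (blast intro: finite_subset)
    moreover have "W.span C = C"
      using W.in_own_span[of C] W.span_is_subset2[of C] by simp
    ultimately have "W.fin_dim" unfolding W.fin_dim_def by auto
    from W.card_carrier_eq_power_dim[OF _ this] show ?thesis
      by (simp add: class_ring_simps card_UNIV_bit)
  qed
  then show ?thesis
    unfolding binary_code_def subspace_bit_iff by auto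
qed

lemma bit_add_self [simp]: "b + b = (0 :: bit)"
  by (cases b) simp_all

lemma bit_add_self_left [simp]: "b + (b + c) = (c :: bit)"
  by (simp flip: add.assoc)

lemma bit_mult_self [simp]: "b * b = (b :: bit)"
  by (cases b) simp_all

section \<open>First order Reed--Muller codes as affine functions\<close>

text \<open>The recursion of \<^const>\<open>reed_muller1\<close> adds the new variable as the top bit of the position, so
  position \<open>i\<close> carries the point whose \<open>t\<close>-th coordinate is the \<open>t\<close>-th binary digit of \<open>i\<close>.\<close>

definition coord :: "nat \<Rightarrow> nat \<Rightarrow> bit" where
  "coord t i = of_bool (bit i t)"

definition affine_vec :: "nat \<Rightarrow> bit \<Rightarrow> (nat \<Rightarrow> bit) \<Rightarrow> bit vec" where
  "affine_vec m c l = vec (2 ^ m) (\<lambda>i. c + (\<Sum>t<m. l t * coord t i))"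

lemma coord_lt: "i < 2 ^ t \<Longrightarrow> coord t i = 0"
  by (simp add: coord_def) (metis bit_take_bit_iff less_irrefl take_bit_nat_eq_self)

lemma coord_add_top: "i < 2 ^ m \<Longrightarrow> t < m \<Longrightarrow> coord t (i + 2 ^ m) = coord t i"
proof -
  assume "i < 2 ^ m" "t < m"
  then have "bit (i + 2 ^ m) t = bit (take_bit m (i + 2 ^ m)) t"
    by (simp add: bit_take_bit_iff)
  also have "take_bit m (i + 2 ^ m) = i"
    using \<open>i < 2 ^ m\<close> by (simp add: take_bit_eq_mod)
  finally show ?thesis by (simp add: coord_def)
qed

lemma coord_top: "i < 2 ^ m \<Longrightarrow> coord m (i + 2 ^ m) = 1"
  by (simp add: coord_def bit_iff_odd)

text \<open>The variable with index \<open>m\<close> is 0 on the first half of the positions and 1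
  on the second, so its coefficient decides whether the second half repeats or complements the
  first.\<close>

lemma affine_vec_Suc:
  "affine_vec (Suc m) c l =
     affine_vec m c l @\<^sub>v (if l m = 0 then affine_vec m c l
                          else affine_vec m c l + ones_vec (2 ^ m))"
proof (rule eq_vecI)
  fix i assume "i < dim_vec (affine_vec m c l @\<^sub>v (if l m = 0 then affine_vec m c l
                          else affine_vec m c l + ones_vec (2 ^ m)))"
  then have i: "i < 2 ^ Suc m" by (auto simp: affine_vec_def ones_vec_def split: if_splits)
  show "affine_vec (Suc m) c l $ i = (affine_vec m c l @\<^sub>v (if l m = 0 then affine_vec m c l
                          else affine_vec m c l + ones_vec (2 ^ m))) $ i"
  proof (cases "i < 2 ^ m")
    case True
    then show ?thesis by (simp add: affine_vec_def coord_lt)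
  next
    case False
    define j where "j = i - 2 ^ m"
    have j: "i = j + 2 ^ m" "j < 2 ^ m" using False i by (auto simp: j_def)
    have "(\<Sum>t<m. l t * coord t i) = (\<Sum>t<m. l t * coord t j)"
      using j by (intro sum.cong) (simp_all add: coord_add_top)
    then show ?thesis using j
      by (cases "l m") (simp_all add: affine_vec_def ones_vec_def coord_top add.assoc)
  qed
qed (auto simp: affine_vec_def ones_vec_def)

lemma affine_vec_cong: "(\<And>t. t < m \<Longrightarrow> l t = l' t) \<Longrightarrow> affine_vec m c l = affine_vec m c l'"
  by (auto simp: affine_vec_def intro!: sum.cong)

text \<open>The value chosen at 0 makes the recursive step valid there as well, so inductions can
  start at \<open>m = 0\<close>.\<close>

lemma reed_muller1_Suc_eq:
  "reed_muller1 (Suc m) = {u @\<^sub>v u | u. u \<in> reed_muller1 m} \<union>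
     {u @\<^sub>v (u + ones_vec (2 ^ m)) | u. u \<in> reed_muller1 m}"
proof (cases m)
  case 0
  have "v \<in> {u @\<^sub>v u | u. u \<in> carrier_vec 1} \<union> {u @\<^sub>v (u + ones_vec 1) | u. u \<in> carrier_vec 1}"
    if v: "v \<in> carrier_vec 2" for v :: "bit vec"
  proof -
    let ?u = "vec 1 (\<lambda>_. v $ 0)"
    have "v = ?u @\<^sub>v (if v $ 0 = v $ 1 then ?u else ?u + ones_vec 1)"
    proof (rule eq_vecI)
      fix i assume "i < dim_vec (?u @\<^sub>v (if v $ 0 = v $ 1 then ?u else ?u + ones_vec 1))"
      then have "i = 0 \<or> i = 1" by (auto simp: ones_vec_def split: if_splits)
      then show "v $ i = (?u @\<^sub>v (if v $ 0 = v $ 1 then ?u else ?u + ones_vec 1)) $ i"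
        by (cases "v $ 0"; cases "v $ 1") (auto simp: ones_vec_def)
    qed (use v in \<open>auto simp: ones_vec_def\<close>)
    moreover have "?u \<in> carrier_vec 1" by simp
    ultimately show ?thesis by (cases "v $ 0 = v $ 1") auto
  qed
  moreover have "u @\<^sub>v u \<in> carrier_vec 2" "u @\<^sub>v (u + ones_vec 1) \<in> carrier_vec 2"
    if "u \<in> carrier_vec 1" for u :: "bit vec"
    using append_carrier_vec[of u 1 u 1] append_carrier_vec[of u 1 "u + ones_vec 1" 1] that
    by (simp_all add: ones_vec_def numeral_2_eq_2)
  ultimately have "carrier_vec 2 = {u @\<^sub>v u | u. u \<in> carrier_vec 1} \<union>
      {u @\<^sub>v (u + ones_vec 1) | u. u \<in> (carrier_vec 1 :: bit vec set)}"
    by blast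
  then show ?thesis unfolding 0 by simp
next
  case (Suc n)
  then show ?thesis by simp
qed

lemma reed_muller1_eq_affine: "reed_muller1 m = {affine_vec m c l | c l. True}"
proof (induction m)
  case 0
  have "v = affine_vec 0 (v $ 0) (\<lambda>_. 0)" if "v \<in> carrier_vec 1" for v
    using that by (auto simp: affine_vec_def)
  then show ?case by (auto simp: affine_vec_def)
next
  case (Suc m)
  show ?case
  proof (intro equalityI subsetI)
    fix v assume "v \<in> reed_muller1 (Suc m)"
    then obtain c l b where v: "v = affine_vec m c l @\<^sub>v
        (if b = (0::bit) then affine_vec m c l else affine_vec m c l + ones_vec (2 ^ m))"
      unfolding reed_muller1_Suc_eq Suc.IH by (fastforce intro: that[of _ _ 0] that[of _ _ 1])
    have "affine_vec m c (l(m := b)) = affine_vec m c l" by (rule affine_vec_cong) simp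
    then have "v = affine_vec (Suc m) c (l(m := b))"
      unfolding v affine_vec_Suc by (simp only: fun_upd_same)
    then show "v \<in> {affine_vec (Suc m) c l | c l. True}" by blast
  next
    fix v assume "v \<in> {affine_vec (Suc m) c l | c l. True}"
    then obtain c l where "v = affine_vec (Suc m) c l" by blast
    then show "v \<in> reed_muller1 (Suc m)"
      unfolding reed_muller1_Suc_eq Suc.IH affine_vec_Suc by (cases "l m = 0") auto
  qed
qed

lemma affine_vec_add:
  "affine_vec m c l + affine_vec m c' l' = affine_vec m (c + c') (\<lambda>t. l t + l' t)"
  by (intro eq_vecI) (simp_all add: affine_vec_def sum.distrib distrib_right add_ac)

lemma reed_muller1_carrier: "v \<in> reed_muller1 m \<Longrightarrow> v \<in> carrier_vec (2 ^ m)"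
  by (auto simp: reed_muller1_eq_affine affine_vec_def)

lemma reed_muller1_add: "u \<in> reed_muller1 m \<Longrightarrow> v \<in> reed_muller1 m \<Longrightarrow> u + v \<in> reed_muller1 m"
  unfolding reed_muller1_eq_affine using affine_vec_add by blast

lemma zero_in_reed_muller1: "0\<^sub>v (2 ^ m) \<in> reed_muller1 m"
proof -
  have "0\<^sub>v (2 ^ m) = affine_vec m 0 (\<lambda>_. 0)" by (auto simp: affine_vec_def)
  then show ?thesis unfolding reed_muller1_eq_affine by blast
qed

lemma finite_reed_muller1: "finite (reed_muller1 m)"
  using finite_subset[OF _ finite_carrier_vec_bit] reed_muller1_carrier by blast

lemma coord_power: "coord t (2 ^ s) = of_bool (s = t)"
  by (auto simp: coord_def bit_exp_iff)

text \<open>Position 0 is the origin and position \<open>2 ^ s\<close> the unit vector in direction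
  \<open>s\<close>; the values there recover the constant and all linear coefficients.\<close>

lemma card_reed_muller1: "card (reed_muller1 m) = 2 ^ Suc m"
proof -
  let ?A = "(UNIV :: bit set) \<times> ({..<m} \<rightarrow>\<^sub>E (UNIV :: bit set))"
  have "inj_on (\<lambda>(c, l). affine_vec m c l) ?A"
  proof (rule inj_onI, clarsimp)
    fix c c' l l' assume l: "l \<in> {..<m} \<rightarrow>\<^sub>E (UNIV :: bit set)" "l' \<in> {..<m} \<rightarrow>\<^sub>E (UNIV :: bit set)"
      and eq: "affine_vec m c l = affine_vec m c' l'"
    have "affine_vec m c l $ 0 = c" "affine_vec m c' l' $ 0 = c'"
      by (simp_all add: affine_vec_def coord_lt)
    then have c: "c = c'" using eq by simp
    have "affine_vec m c k $ (2 ^ s) = c + k s" if "s < m" for s k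
      using that by (simp add: affine_vec_def coord_power of_bool_def if_distrib[of "(*) _"] cong: if_cong)
    from this[of _ l] this[of _ l'] have "l s = l' s" if "s < m" for s
      using that eq c by simp
    then have "l = l'" using l by (intro PiE_ext[of l "{..<m}" "\<lambda>_. UNIV" l']) auto
    then show "c = c' \<and> l = l'" using c by simp
  qed
  moreover have "(\<lambda>(c, l). affine_vec m c l) ` ?A = reed_muller1 m"
  proof (intro equalityI subsetI)
    fix v assume "v \<in> reed_muller1 m"
    then obtain c l where "v = affine_vec m c l" unfolding reed_muller1_eq_affine by blast
    then have "v = affine_vec m c (restrict l {..<m})" by (simp add: affine_vec_cong[of m l "restrict l {..<m}"])
    then show "v \<in> (\<lambda>(c, l). affine_vec m c l) ` ?A"
      by (intro image_eqI[where x = "(c, restrict l {..<m})"]) auto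
  qed (auto simp: reed_muller1_eq_affine)
  ultimately have "card (reed_muller1 m) = card ?A" by (metis card_image)
  then show ?thesis by (simp add: card_cartesian_product card_funcsetE card_UNIV_bit)
qed

section \<open>Weights and Parseval's identity\<close>

definition bint :: "bit \<Rightarrow> int" where
  "bint b = of_bool (b = 1)"

lemma bint_simps [simp]: "bint 0 = 0" "bint 1 = 1"
  by (simp_all add: bint_def)

lemma bint_add: "bint (x + y) = bint x + bint y - 2 * bint (x * y)"
  by (cases x; cases y) simp_all

text \<open>Reduction modulo 2 of an integer count; it turns a parity statement about overlaps of
  supports into orthogonality.\<close>

lemma even_sum_bint: "even (\<Sum>i\<in>A. bint (f i)) \<longleftrightarrow> (\<Sum>i\<in>A. f i) = 0"
proof (induction A rule: infinite_finite_induct)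
  case (insert x A)
  then show ?case
    by (cases "f x"; cases "\<Sum>i\<in>A. f i") (simp_all del: sum_eq_0_iff)
qed simp_all

lemma weight_eq_sum:
  assumes "v \<in> carrier_vec n"
  shows "int (weight v) = (\<Sum>i<n. bint (v $ i))"
proof -
  have "{i. i < dim_vec v \<and> v $ i \<noteq> 0} = {..<n} \<inter> {i. v $ i = 1}"
    using assms by auto
  then show ?thesis by (simp add: weight_def bint_def of_bool_def sum.If_cases)
qed

lemma weight_add:
  assumes "u \<in> carrier_vec n" "v \<in> carrier_vec n"
  shows "int (weight (u + v)) = int (weight u) + int (weight v) - 2 * (\<Sum>i<n. bint (u $ i * v $ i))"
proof -
  have "int (weight (u + v)) = (\<Sum>i<n. bint (u $ i + v $ i))"
    using assms by (simp add: weight_eq_sum[of _ n])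
  also have "\<dots> = (\<Sum>i<n. bint (u $ i) + bint (v $ i) - 2 * bint (u $ i * v $ i))"
    by (simp only: bint_add)
  finally show ?thesis
    using assms by (simp add: weight_eq_sum[of _ n] sum.distrib sum_subtractf sum_distrib_left)
qed

text \<open>Expanding the squares gives correlations between pairs of positions. For two distinct
  positions, translating \<open>R\<close> by a word that separates them negates the correlation, so
  it vanishes and only the diagonal terms survive.\<close>

lemma sum_squared_weight_deviation:
  fixes R :: "bit vec set"
  assumes R: "R \<subseteq> carrier_vec n" and fin: "finite R"
    and add: "\<And>u v. u \<in> R \<Longrightarrow> v \<in> R \<Longrightarrow> u + v \<in> R"
    and sep: "\<And>i j. i < n \<Longrightarrow> j < n \<Longrightarrow> i \<noteq> j \<Longrightarrow> \<exists>g\<in>R. g $ i \<noteq> g $ j"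
    and f: "f \<in> carrier_vec n"
  shows "(\<Sum>r\<in>R. (int n - 2 * int (weight (f + r)))\<^sup>2) = int n * int (card R)"
proof -
  \<comment> \<open>The sign character \<open>(-1)^b\<close>; the deviation
    \<open>n - 2 * weight\<close> is the sum of the signs of a word.\<close>
  define s where "s b = 1 - 2 * bint b" for b
  have s_add: "s (x + y) = s x * s y" for x y
    by (cases x; cases y) (simp_all add: s_def)
  have s_sq: "s x * s x = 1" for x by (cases x) (simp_all add: s_def)
  have s_neq: "s x * s y = -1" if "x \<noteq> y" for x y
    using that by (cases x; cases y) (simp_all add: s_def)
  have wt: "int n - 2 * int (weight (f + r)) = (\<Sum>i<n. s (f $ i) * s (r $ i))" if "r \<in> R" for r
  proof -
    have r: "r \<in> carrier_vec n" using that R by blast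
    have "int n - 2 * int (weight (f + r)) = (\<Sum>i<n. s (f $ i + r $ i))"
      using r f by (simp add: weight_eq_sum[of _ n] s_def sum_subtractf sum_distrib_left)
    then show ?thesis by (simp only: s_add)
  qed
  have corr: "(\<Sum>r\<in>R. s (r $ i) * s (r $ j)) = (if i = j then int (card R) else 0)"
    if ij: "i < n" "j < n" for i j
  proof (cases "i = j")
    case True
    then show ?thesis by (simp add: s_sq)
  next
    case False
    obtain g where g: "g \<in> R" "g $ i \<noteq> g $ j" using sep[OF ij False] by blast
    have inv: "g + (g + r) = r" if "r \<in> R" for r
      using that g R by (intro eq_vecI) auto
    have "bij_betw ((+) g) R R"
      using inv add[OF g(1)] by (intro bij_betw_byWitness[where f' = "(+) g"]) auto
    then have "(\<Sum>r\<in>R. s (r $ i) * s (r $ j)) = (\<Sum>r\<in>R. s ((g + r) $ i) * s ((g + r) $ j))"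
      by (rule sum.reindex_bij_betw[symmetric])
    also have "\<dots> = (\<Sum>r\<in>R. (s (g $ i) * s (g $ j)) * (s (r $ i) * s (r $ j)))"
    proof (intro sum.cong refl)
      fix r assume "r \<in> R"
      then have "r \<in> carrier_vec n" using R by blast
      then show "s ((g + r) $ i) * s ((g + r) $ j) = s (g $ i) * s (g $ j) * (s (r $ i) * s (r $ j))"
        using ij by (simp add: s_add)
    qed
    also have "\<dots> = - (\<Sum>r\<in>R. s (r $ i) * s (r $ j))"
      unfolding s_neq[OF g(2)] by (simp add: sum_negf)
    finally show ?thesis using False by simp
  qed
  have "(\<Sum>r\<in>R. (int n - 2 * int (weight (f + r)))\<^sup>2)
      = (\<Sum>r\<in>R. \<Sum>i<n. \<Sum>j<n. (s (f $ i) * s (f $ j)) * (s (r $ i) * s (r $ j)))"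
    by (intro sum.cong refl) (simp add: wt power2_eq_square sum_product mult_ac)
  also have "\<dots> = (\<Sum>i<n. \<Sum>j<n. (s (f $ i) * s (f $ j)) * (\<Sum>r\<in>R. s (r $ i) * s (r $ j)))"
    by (simp add: sum.swap[of _ _ R] sum_distrib_left)
  also have "\<dots> = (\<Sum>i<n. \<Sum>j<n. if j = i then int (card R) else 0)"
    by (intro sum.cong refl) (auto simp: corr s_sq)
  also have "\<dots> = int n * int (card R)" by simp
  finally show ?thesis .
qed

section \<open>Quadratic functions of four variables\<close>

type_synonym form = "bit \<times> bit \<times> bit \<times> bit \<times> bit \<times> bit"

text \<open>The tuple lists the coefficients of \<open>x0 x1, x0 x2, x0 x3, x1 x2, x1 x3, x2 x3\<close>.\<close>

fun quad :: "form \<Rightarrow> nat \<Rightarrow> bit" where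
  "quad (a, b, c, d, e, f) i =
     a * coord 0 i * coord 1 i + b * coord 0 i * coord 2 i + c * coord 0 i * coord 3 i +
     d * coord 1 i * coord 2 i + e * coord 1 i * coord 3 i + f * coord 2 i * coord 3 i"

definition quad_vec :: "form \<Rightarrow> bit vec" where
  "quad_vec a = vec 16 (quad a)"

text \<open>The Pfaffian of the alternating 4 by 4 matrix with these upper triangular entries,
  without signs in characteristic 2; its zeros form the Klein quadric.\<close>

fun pfaffian :: "form \<Rightarrow> bit" where
  "pfaffian (a, b, c, d, e, f) = a * f + b * e + c * d"

text \<open>Second differences at the origin; they recover the coefficients of a quadratic function.\<close>

definition hessian :: "bit vec \<Rightarrow> form" where
  "hessian v = (v $ 0 + v $ 1 + v $ 2 + v $ 3, v $ 0 + v $ 1 + v $ 4 + v $ 5,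
     v $ 0 + v $ 1 + v $ 8 + v $ 9, v $ 0 + v $ 2 + v $ 4 + v $ 6,
     v $ 0 + v $ 2 + v $ 8 + v $ 10, v $ 0 + v $ 4 + v $ 8 + v $ 12)"

definition code_of :: "form set \<Rightarrow> bit vec set" where
  "code_of U = {quad_vec a + r | a r. a \<in> U \<and> r \<in> reed_muller1 4}"

lemma sum_lessThan_4: "(\<Sum>t<4. f t) = f 0 + f 1 + f 2 + f (3::nat)" for f :: "nat \<Rightarrow> 'a::comm_monoid_add"
  by (simp add: eval_nat_numeral One_nat_def add_ac)

lemma sum_lessThan_16: "(\<Sum>t<16. f t) = f 0 + f 1 + f 2 + f 3 + f 4 + f 5 + f 6 + f 7
   + f 8 + f 9 + f 10 + f 11 + f 12 + f 13 + f 14 + f (15::nat)" for f :: "nat \<Rightarrow> 'a::comm_monoid_add"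
  by (simp add: eval_nat_numeral One_nat_def add_ac)

lemma quad_vec_carrier [simp]: "quad_vec a \<in> carrier_vec 16"
  by (simp add: quad_vec_def)

lemma quad_add: "quad (a + b) i = quad a i + quad b i"
  by (cases a; cases b) (simp add: algebra_simps del: minus_bit_def)

lemma quad_vec_add: "quad_vec a + quad_vec b = quad_vec (a + b)"
  by (auto simp: quad_vec_def quad_add)

lemma reed_muller1_4_carrier: "r \<in> reed_muller1 4 \<Longrightarrow> r \<in> carrier_vec 16"
  using reed_muller1_carrier[of r 4] by simp

lemma hessian_add: "u \<in> carrier_vec 16 \<Longrightarrow> v \<in> carrier_vec 16 \<Longrightarrow> hessian (u + v) = hessian u + hessian v"
  by (simp add: hessian_def add_ac)

lemma hessian_quad_vec: "hessian (quad_vec a) = a"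
  by (cases a) (simp add: hessian_def quad_vec_def coord_def bit_iff_odd)

text \<open>Second differences kill affine functions, so \<open>hessian\<close> reads off the
  quadratic part of a word modulo RM(1,4).\<close>

lemma hessian_reed_muller1: "r \<in> reed_muller1 4 \<Longrightarrow> hessian r = 0"
  by (auto simp: reed_muller1_eq_affine hessian_def affine_vec_def sum_lessThan_4 coord_def bit_iff_odd
      zero_prod_def add_ac)

lemma all_less_16: "(\<forall>i<16. P i) \<longleftrightarrow> P 0 \<and> P 1 \<and> P 2 \<and> P 3 \<and> P 4 \<and> P 5 \<and> P 6 \<and> P 7
   \<and> P 8 \<and> P 9 \<and> P 10 \<and> P 11 \<and> P 12 \<and> P 13 \<and> P 14 \<and> P (15::nat)"
  by (simp add: eval_nat_numeral One_nat_def All_less_Suc conj_ac)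

text \<open>This is the duality of RM(1,4) and RM(2,4). Five orthogonality relations determine the
  values at the points with three or four nonzero coordinates (7, 11, 13, 14, 15) from the other
  eleven values, and those are interpolated by a quadratic function.\<close>

lemma orthogonal_reed_muller1:
  assumes f: "f \<in> carrier_vec 16"
    and orth: "\<And>r. r \<in> reed_muller1 4 \<Longrightarrow> (\<Sum>i<16. f $ i * r $ i) = 0"
  shows "\<exists>r\<in>reed_muller1 4. f = quad_vec (hessian f) + r"
proof -
  have E: "(\<Sum>i<16. f $ i * (c + (\<Sum>t<4. l t * coord t i))) = 0" for c l
  proof -
    have "affine_vec 4 c l \<in> reed_muller1 4" by (auto simp: reed_muller1_eq_affine)
    from orth[OF this] show ?thesis by (simp add: affine_vec_def)
  qed
  note ev = sum_lessThan_16 sum_lessThan_4 coord_def bit_iff_odd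
  have e: "(\<Sum>i<16. f $ i) = 0" using E[of 1 "\<lambda>_. 0"] by simp
  have e0: "(\<Sum>i<16. f $ i * coord 0 i) = 0" using E[of 0 "\<lambda>t. of_bool (t = 0)"] by (simp add: sum_lessThan_4)
  have e1: "(\<Sum>i<16. f $ i * coord 1 i) = 0" using E[of 0 "\<lambda>t. of_bool (t = 1)"] by (simp add: sum_lessThan_4)
  have e2: "(\<Sum>i<16. f $ i * coord 2 i) = 0" using E[of 0 "\<lambda>t. of_bool (t = 2)"] by (simp add: sum_lessThan_4)
  have e3: "(\<Sum>i<16. f $ i * coord 3 i) = 0" using E[of 0 "\<lambda>t. of_bool (t = 3)"] by (simp add: sum_lessThan_4)
  \<comment> \<open>Adding the relations for the constant 1 and for coordinate 3 leaves the sum over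
    the subcube where coordinate 3 is 0, whose top point is 7. The next three values arise in the
    same way.\<close>
  have f7: "f $ 7 = f $ 0 + f $ 1 + f $ 2 + f $ 3 + f $ 4 + f $ 5 + f $ 6"
  proof -
    have "f $ 7 = f $ 7 + ((\<Sum>i<16. f $ i) + (\<Sum>i<16. f $ i * coord 3 i))" by (simp add: e e3)
    also have "\<dots> = f $ 0 + f $ 1 + f $ 2 + f $ 3 + f $ 4 + f $ 5 + f $ 6" unfolding ev by (simp add: add_ac)
    finally show ?thesis .
  qed
  have f11: "f $ 11 = f $ 0 + f $ 1 + f $ 2 + f $ 3 + f $ 8 + f $ 9 + f $ 10"
  proof -
    have "f $ 11 = f $ 11 + ((\<Sum>i<16. f $ i) + (\<Sum>i<16. f $ i * coord 2 i))" by (simp add: e e2)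
    also have "\<dots> = f $ 0 + f $ 1 + f $ 2 + f $ 3 + f $ 8 + f $ 9 + f $ 10" unfolding ev by (simp add: add_ac)
    finally show ?thesis .
  qed
  have f13: "f $ 13 = f $ 0 + f $ 1 + f $ 4 + f $ 5 + f $ 8 + f $ 9 + f $ 12"
  proof -
    have "f $ 13 = f $ 13 + ((\<Sum>i<16. f $ i) + (\<Sum>i<16. f $ i * coord 1 i))" by (simp add: e e1)
    also have "\<dots> = f $ 0 + f $ 1 + f $ 4 + f $ 5 + f $ 8 + f $ 9 + f $ 12" unfolding ev by (simp add: add_ac)
    finally show ?thesis .
  qed
  have f14: "f $ 14 = f $ 0 + f $ 2 + f $ 4 + f $ 6 + f $ 8 + f $ 10 + f $ 12"
  proof -
    have "f $ 14 = f $ 14 + ((\<Sum>i<16. f $ i) + (\<Sum>i<16. f $ i * coord 0 i))" by (simp add: e e0)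
    also have "\<dots> = f $ 0 + f $ 2 + f $ 4 + f $ 6 + f $ 8 + f $ 10 + f $ 12" unfolding ev by (simp add: add_ac)
    finally show ?thesis .
  qed
  have f15: "f $ 15 = f $ 0 + f $ 1 + f $ 2 + f $ 3 + f $ 4 + f $ 5 + f $ 6 + f $ 7 + f $ 8 + f $ 9 + f $ 10 + f $ 11 + f $ 12 + f $ 13 + f $ 14"
  proof -
    have "f $ 15 = f $ 15 + ((\<Sum>i<16. f $ i))" by (simp add: e)
    also have "\<dots> = f $ 0 + f $ 1 + f $ 2 + f $ 3 + f $ 4 + f $ 5 + f $ 6 + f $ 7 + f $ 8 + f $ 9 + f $ 10 + f $ 11 + f $ 12 + f $ 13 + f $ 14" unfolding ev by (simp add: add_ac)
    finally show ?thesis .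
  qed
  \<comment> \<open>First differences at the origin give the linear coefficients, as
    \<open>hessian\<close> gives the quadratic ones.\<close>
  define l where "l t = f $ 0 + f $ (2 ^ t)" for t
  define g where "g = quad_vec (hessian f) + affine_vec 4 (f $ 0) l"
  have "f = g"
  proof (rule eq_vecI)
    have "\<forall>i<16. f $ i = g $ i"
      unfolding all_less_16
      by (simp add: g_def quad_vec_def hessian_def affine_vec_def l_def ev f7 f11 f13 f14 f15 add_ac)
    moreover have "dim_vec g = 16" by (simp add: g_def affine_vec_def)
    ultimately show "f $ i = g $ i" if "i < dim_vec g" for i
      using that by metis
  qed (use f in \<open>simp add: g_def affine_vec_def\<close>)
  then show ?thesis unfolding g_def by (auto simp: reed_muller1_eq_affine)
qed

section \<open>Transvections\<close>

text \<open>The coordinate permutation induced by the substitution \<open>x\<^sub>s := x\<^sub>s + x\<^sub>t\<close>.\<close>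

definition transvection_perm :: "nat \<Rightarrow> nat \<Rightarrow> nat \<Rightarrow> nat" where
  "transvection_perm s t i = (if i < 16 \<and> bit i t then flip_bit s i else i)"

lemma flip_bit_less_16: "s < 4 \<Longrightarrow> i < 16 \<Longrightarrow> flip_bit s i < (16 :: nat)"
proof -
  assume "s < 4" "i < 16"
  then have "take_bit 4 (flip_bit s i) = flip_bit s i"
    using take_bit_nat_eq_self[of i 4] by (simp add: take_bit_flip_bit_eq)
  then show ?thesis using take_bit_nat_less_exp[of 4 "flip_bit s i"] by simp
qed

lemma transvection_perm_invol:
  assumes "s < 4" "s \<noteq> t"
  shows "transvection_perm s t (transvection_perm s t i) = i"
proof -
  have "flip_bit s (flip_bit s i) = i" by (rule bit_eqI) (auto simp: bit_flip_bit_iff)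
  then show ?thesis
    using assms flip_bit_less_16[of s i] by (auto simp: transvection_perm_def bit_flip_bit_iff)
qed

lemma transvection_perm_less: "s < 4 \<Longrightarrow> i < 16 \<Longrightarrow> transvection_perm s t i < 16"
  by (simp add: transvection_perm_def flip_bit_less_16)

lemma transvection_perm_permutes:
  assumes "s < 4" "s \<noteq> t"
  shows "transvection_perm s t permutes {..<16}"
  using assms transvection_perm_invol[OF assms]
  by (intro bij_imp_permutes bij_betw_byWitness[where f' = "transvection_perm s t"])
    (auto simp: transvection_perm_less, simp add: transvection_perm_def)

lemma coord_transvection_perm:
  assumes "i < 16" "s \<noteq> t"
  shows "coord r (transvection_perm s t i) = coord r i + of_bool (r = s) * coord t i"
  using assms by (simp add: coord_def transvection_perm_def bit_flip_bit_iff)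

lemma affine_vec_in_reed_muller1: "affine_vec m c l \<in> reed_muller1 m"
  unfolding reed_muller1_eq_affine by blast

text \<open>Replacing \<open>x_s\<close> by \<open>x_s + x_t\<close> adds the coefficient of
  \<open>x_s\<close> to that of \<open>x_t\<close>; hence the permutation preserves RM(1,4).\<close>

lemma permute_affine_vec:
  assumes "s < 4" "t < 4" "s \<noteq> t"
  shows "permute_vec (transvection_perm s t) (affine_vec 4 c l) = affine_vec 4 c (l(t := l t + l s))"
proof (rule eq_vecI)
  fix i assume "i < dim_vec (affine_vec 4 c (l(t := l t + l s)))"
  then have i: "i < 16" by (simp add: affine_vec_def)
  have "(\<Sum>r<4. (l(t := l t + l s)) r * coord r i) = (\<Sum>r<4. l r * coord r i + of_bool (r = t) * (l s * coord t i))"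
    by (intro sum.cong) (auto simp: distrib_right)
  also have "\<dots> = (\<Sum>r<4. l r * coord r i) + l s * coord t i"
    using assms by (simp add: sum.distrib of_bool_def if_distrib[of "\<lambda>x. x * _"] cong: if_cong)
  finally show "permute_vec (transvection_perm s t) (affine_vec 4 c l) $ i = affine_vec 4 c (l(t := l t + l s)) $ i"
    using i assms
    by (simp add: permute_vec_def affine_vec_def transvection_perm_less coord_transvection_perm distrib_left sum.distrib
        of_bool_def if_distrib[of "\<lambda>x. x * _"] if_distrib[of "\<lambda>x. _ * x"] add.assoc cong: if_cong)
qed (simp add: permute_vec_def affine_vec_def)

lemma permute_vec_add:
  assumes "u \<in> carrier_vec n" "v \<in> carrier_vec n" "p permutes {..<n}"
  shows "permute_vec p (u + v) = permute_vec p u + permute_vec p v"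
  using assms permutes_in_image[OF assms(3)] by (intro eq_vecI) (auto simp: permute_vec_def)

text \<open>An entry \<open>(s, t, T)\<close> records the effect \<open>T\<close> of \<open>x\<^sub>s := x\<^sub>s + x\<^sub>t\<close> on the coefficients. The block
  transvections fix the coefficients of \<open>x0 x1\<close> and \<open>x2 x3\<close> and act by row and column operations on the
  2 by 2 matrix \<open>(b, c; d, e)\<close> of the others.\<close>

definition block_transvections :: "(nat \<times> nat \<times> (form \<Rightarrow> form)) list" where
  "block_transvections =
     [(0, 1, \<lambda>(a, b, c, d, e, f). (a, b, c, d + b, e + c, f)),
      (1, 0, \<lambda>(a, b, c, d, e, f). (a, b + d, c + e, d, e, f)),
      (2, 3, \<lambda>(a, b, c, d, e, f). (a, b, c + b, d, e + d, f)),
      (3, 2, \<lambda>(a, b, c, d, e, f). (a, b + c, c, d + e, e, f))]"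

text \<open>The two further substitutions mix the variable pairs \<open>x0, x1\<close> and
  \<open>x2, x3\<close>, and so change the coefficients of \<open>x0 x1\<close> and
  \<open>x2 x3\<close>.\<close>

definition transvections :: "(nat \<times> nat \<times> (form \<Rightarrow> form)) list" where
  "transvections = block_transvections @
     [(1, 2, \<lambda>(a, b, c, d, e, f). (a, b + a, c, d, e, f + e)),
      (2, 1, \<lambda>(a, b, c, d, e, f). (a + b, b, c, d, e + f, f))]"

text \<open>\<open>T\<close> is the congruence action of a transvection on alternating matrices: an
  involution in characteristic 2, and of determinant 1, whence the invariance of the
  Pfaffian.\<close>

lemma transvections_props:
  assumes "(s, t, T) \<in> set transvections"
  shows "s < 4" "t < 4" "s \<noteq> t" "T (a + b) = T a + T b" "T (T a) = a" "pfaffian (T a) = pfaffian a"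
proof -
  obtain a1 a2 a3 a4 a5 a6 where "a = (a1, a2, a3, a4, a5, a6)" by (cases a)
  moreover obtain b1 b2 b3 b4 b5 b6 where "b = (b1, b2, b3, b4, b5, b6)" by (cases b)
  moreover note assms
  ultimately show "s < 4" "t < 4" "s \<noteq> t" "T (a + b) = T a + T b" "T (T a) = a" "pfaffian (T a) = pfaffian a"
    by (auto simp: transvections_def block_transvections_def add_ac distrib_left distrib_right mult_ac)
qed

lemma transvection_quad:
  assumes "(s, t, T) \<in> set transvections"
  shows "\<exists>k. \<forall>i<16. quad a (transvection_perm s t i) = quad (T a) i + k * coord t i"
proof -
  obtain a1 a2 a3 a4 a5 a6 where a: "a = (a1, a2, a3, a4, a5, a6)" by (cases a)
  \<comment> \<open>The term \<open>x_s x_t\<close> becomes \<open>x_s x_t + x_t\<close>, because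
    squares of bits are the bits themselves. So \<open>k\<close> is the coefficient of
    \<open>x_s x_t\<close>: \<open>a1\<close> for the pair 0, 1, \<open>a4\<close> for 1, 2 and
    \<open>a6\<close> for 2, 3.\<close>
  have "\<exists>k\<in>{a1, a4, a6}. \<forall>i<16. quad a (transvection_perm s t i) = quad (T a) i + k * coord t i"
    using assms unfolding a transvections_def block_transvections_def
    by (auto simp: coord_transvection_perm distrib_left distrib_right algebra_simps)
  then show ?thesis by blast
qed

lemma permute_quad_vec:
  assumes "(s, t, T) \<in> set transvections"
  shows "\<exists>r\<in>reed_muller1 4. permute_vec (transvection_perm s t) (quad_vec a) = quad_vec (T a) + r"
proof -
  note st = transvections_props(1-3)[OF assms]
  obtain k where k: "\<forall>i<16. quad a (transvection_perm s t i) = quad (T a) i + k * coord t i"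
    using transvection_quad[OF assms] by blast
  have "(\<Sum>r<4. (if r = t then k else 0) * coord r i) = k * coord t i" for i
    using st by (simp add: if_distrib[of "\<lambda>x. x * _"] cong: if_cong)
  then have "permute_vec (transvection_perm s t) (quad_vec a) = quad_vec (T a) + affine_vec 4 0 (\<lambda>r. if r = t then k else 0)"
    using k st by (intro eq_vecI) (auto simp: permute_vec_def quad_vec_def affine_vec_def transvection_perm_less)
  then show ?thesis by (auto simp: reed_muller1_eq_affine)
qed

lemma code_of_carrier: "code_of U \<subseteq> carrier_vec 16"
  by (auto simp: code_of_def dest: reed_muller1_4_carrier)

text \<open>The permutation acts on quadratic parts as \<open>T\<close> modulo RM(1,4), which gives
  one inclusion. Both the permutation and \<open>T\<close> are involutions, so the same inclusion
  for the image of \<open>U\<close> gives the other.\<close>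

lemma code_equivalent_transvection:
  assumes "(s, t, T) \<in> set transvections"
  shows "code_equivalent 16 (code_of U) (code_of (T ` U))"
proof -
  note st = transvections_props(1-3)[OF assms]
  let ?p = "transvection_perm s t"
  have p: "?p permutes {..<16}" using st by (intro transvection_perm_permutes)
  have sub: "permute_vec ?p ` code_of V \<subseteq> code_of (T ` V)" for V
  proof clarify
    fix v assume "v \<in> code_of V"
    then obtain a r where v: "v = quad_vec a + r" "a \<in> V" "r \<in> reed_muller1 4"
      by (auto simp: code_of_def)
    obtain r' where r': "r' \<in> reed_muller1 4" "permute_vec ?p (quad_vec a) = quad_vec (T a) + r'"
      using permute_quad_vec[OF assms] by blast
    have "permute_vec ?p r \<in> reed_muller1 4"
      using v(3) st affine_vec_in_reed_muller1 by (auto simp: reed_muller1_eq_affine permute_affine_vec)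
    moreover have "permute_vec ?p v = quad_vec (T a) + (r' + permute_vec ?p r)"
      unfolding v(1) permute_vec_add[OF quad_vec_carrier reed_muller1_4_carrier[OF v(3)] p] r'(2)
      by (rule assoc_add_vec[of _ 16]) (use calculation r'(1) reed_muller1_4_carrier in auto)
    ultimately show "permute_vec ?p v \<in> code_of (T ` V)"
      using v(2) r'(1) reed_muller1_add unfolding code_of_def by blast
  qed
  have "permute_vec ?p (permute_vec ?p v) = v" if "v \<in> carrier_vec 16" for v :: "bit vec"
  proof -
    have "?p \<circ> ?p = id" using st by (auto simp: transvection_perm_invol)
    then show ?thesis using permute_vec_comp[OF that p, of ?p] by (simp add: permute_vec_id)
  qed
  moreover have "T ` T ` U = U" using transvections_props(5)[OF assms] by (simp add: image_image)
  ultimately have "code_of (T ` U) \<subseteq> permute_vec ?p ` code_of U"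
    using sub[of "T ` U"] code_of_carrier[of "T ` U"] by (auto intro!: image_eqI)
  then have "code_of (T ` U) = permute_vec ?p ` code_of U" using sub[of U] by blast
  then show ?thesis unfolding code_equivalent_def using code_of_carrier p by blast
qed

section \<open>Compositions of transvections and their orbits on forms\<close>

inductive_set moves :: "(nat \<times> nat \<times> (form \<Rightarrow> form)) list \<Rightarrow> (form \<Rightarrow> form) set" for ts where
  id_moves: "id \<in> moves ts"
| comp_moves: "g \<in> moves ts \<Longrightarrow> (s, t, T) \<in> set ts \<Longrightarrow> g \<circ> T \<in> moves ts"

lemma moves_props:
  assumes "g \<in> moves ts" "set ts \<subseteq> set transvections"
  shows "g (a + b) = g a + g b" "pfaffian (g a) = pfaffian a" "inj g"
    "code_equivalent 16 (code_of U) (code_of (g ` U))"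
proof -
  have "(\<forall>a b. g (a + b) = g a + g b) \<and> (\<forall>a. pfaffian (g a) = pfaffian a) \<and> inj g \<and>
    (\<forall>U. code_equivalent 16 (code_of U) (code_of (g ` U)))"
    using assms(1)
  proof induction
    case id_moves
    then show ?case using code_of_carrier by (auto intro: code_equivalent_refl)
  next
    case (comp_moves g s t T)
    then have T: "(s, t, T) \<in> set transvections" using assms(2) by blast
    have "inj T" using transvections_props(5)[OF T] by (metis injI)
    then have "inj (g \<circ> T)" using comp_moves.IH by (intro inj_compose) auto
    moreover have "code_equivalent 16 (code_of U) (code_of ((g \<circ> T) ` U))" for U
      using code_equivalent_trans[OF code_equivalent_transvection[OF T, of U]] comp_moves.IH
      by (simp only: image_comp[symmetric])
    moreover have "(g \<circ> T) (a + b) = (g \<circ> T) a + (g \<circ> T) b"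
      "pfaffian ((g \<circ> T) a) = pfaffian a" for a b
      unfolding o_apply transvections_props(4)[OF T] using comp_moves.IH transvections_props(6)[OF T]
      by metis+
    ultimately show ?case by blast
  qed
  then show "g (a + b) = g a + g b" "pfaffian (g a) = pfaffian a" "inj g"
    "code_equivalent 16 (code_of U) (code_of (g ` U))" by blast+
qed

definition reach :: "(nat \<times> nat \<times> (form \<Rightarrow> form)) list \<Rightarrow> form \<Rightarrow> form \<Rightarrow> bool" where
  "reach ts a b \<longleftrightarrow> (\<exists>g\<in>moves ts. g a = b)"

lemma reach_refl: "reach ts a a"
  unfolding reach_def using id_moves by (metis id_apply)

text \<open>In \<open>comp_moves\<close> the new transvection acts first, so reachability of a fixed
  target is pulled back along single transvections.\<close>

lemma reach_step: "(s, t, T) \<in> set ts \<Longrightarrow> reach ts (T a) b \<Longrightarrow> reach ts a b"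
  unfolding reach_def using comp_moves by (metis comp_apply)

lemma block_subset: "set block_transvections \<subseteq> set transvections"
  by (auto simp: transvections_def)

lemma block_step:
  assumes "set block_transvections \<subseteq> set ts"
  shows "reach ts (a, b, c, d + b, e + c, f) x \<Longrightarrow> reach ts (a, b, c, d, e, f) x"
    "reach ts (a, b + d, c + e, d, e, f) x \<Longrightarrow> reach ts (a, b, c, d, e, f) x"
    "reach ts (a, b, c + b, d, e + d, f) x \<Longrightarrow> reach ts (a, b, c, d, e, f) x"
    "reach ts (a, b + c, c, d + e, e, f) x \<Longrightarrow> reach ts (a, b, c, d, e, f) x"
  using assms reach_step[of 0 1 "\<lambda>(a, b, c, d, e, f). (a, b, c, d + b, e + c, f)" ts "(a, b, c, d, e, f)"]
    reach_step[of 1 0 "\<lambda>(a, b, c, d, e, f). (a, b + d, c + e, d, e, f)" ts "(a, b, c, d, e, f)"]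
    reach_step[of 2 3 "\<lambda>(a, b, c, d, e, f). (a, b, c + b, d, e + d, f)" ts "(a, b, c, d, e, f)"]
    reach_step[of 3 2 "\<lambda>(a, b, c, d, e, f). (a, b + c, c, d + e, e, f)" ts "(a, b, c, d, e, f)"]
  by (simp_all add: block_transvections_def)

lemma mixed_step:
  "reach transvections (a, b + a, c, d, e, f + e) x \<Longrightarrow> reach transvections (a, b, c, d, e, f) x"
  "reach transvections (a + b, b, c, d, e + f, f) x \<Longrightarrow> reach transvections (a, b, c, d, e, f) x"
  using reach_step[of 1 2 "\<lambda>(a, b, c, d, e, f). (a, b + a, c, d, e, f + e)" transvections "(a, b, c, d, e, f)"]
    reach_step[of 2 1 "\<lambda>(a, b, c, d, e, f). (a + b, b, c, d, e + f, f)" transvections "(a, b, c, d, e, f)"]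
  by (simp_all add: transvections_def)

text \<open>The nine 2 by 2 matrices of rank one form a single orbit under row and column
  operations.\<close>

lemma reach_rank_one:
  assumes ts: "set block_transvections \<subseteq> set ts"
    and base: "reach ts (p, 1, 0, 0, 0, q) x"
    and "b * e + c * d = 0" "(b, c, d, e) \<noteq> 0"
  shows "reach ts (p, b, c, d, e, q) x"
proof -
  note step = block_step[OF ts, of p _ _ _ _ q x]
  have m1010: "reach ts (p, 1, 0, 1, 0, q) x" using step(1)[of 1 0 1 0] base by simp
  have m0010: "reach ts (p, 0, 0, 1, 0, q) x" using step(2)[of 0 1 0 0] m1010 by simp
  have m1100: "reach ts (p, 1, 1, 0, 0, q) x" using step(3)[of 1 1 0 0] base by simp
  have m0100: "reach ts (p, 0, 1, 0, 0, q) x" using step(4)[of 0 1 0 0] m1100 by simp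
  have m1111: "reach ts (p, 1, 1, 1, 1, q) x" using step(1)[of 1 1 1 1] m1100 by simp
  have m0011: "reach ts (p, 0, 0, 1, 1, q) x" using step(2)[of 0 1 0 1] m1111 by simp
  have m0101: "reach ts (p, 0, 1, 0, 1, q) x" using step(4)[of 0 1 0 1] m1111 by simp
  have m0001: "reach ts (p, 0, 0, 0, 1, q) x" using step(4)[of 0 0 0 1] m0011 by simp
  show ?thesis
    using assms(3,4) base m1010 m0010 m1100 m0100 m1111 m0011 m0101 m0001
    by (cases b; cases c; cases d; cases e) (simp_all add: zero_prod_def)
qed

text \<open>The six invertible 2 by 2 matrices likewise form a single orbit.\<close>

lemma reach_rank_two:
  assumes ts: "set block_transvections \<subseteq> set ts"
    and base: "reach ts (p, 1, 0, 0, 1, q) x"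
    and "b * e + c * d = 1"
  shows "reach ts (p, b, c, d, e, q) x"
proof -
  note step = block_step[OF ts, of p _ _ _ _ q x]
  have m1011: "reach ts (p, 1, 0, 1, 1, q) x" using step(1)[of 1 0 1 1] base by simp
  have m1101: "reach ts (p, 1, 1, 0, 1, q) x" using step(3)[of 1 1 0 1] base by simp
  have m0111: "reach ts (p, 0, 1, 1, 1, q) x" using step(2)[of 0 1 1 1] m1011 by simp
  have m1110: "reach ts (p, 1, 1, 1, 0, q) x" using step(1)[of 1 1 1 0] m1101 by simp
  have m0110: "reach ts (p, 0, 1, 1, 0, q) x" using step(1)[of 0 1 1 0] m0111 by simp
  show ?thesis
    using assms(3) base m1011 m1101 m0111 m1110 m0110
    by (cases b; cases c; cases d; cases e) simp_all
qed

text \<open>Transitivity on the points of the Klein quadric. The rank of the block restricts the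
  outer pair: the product \<open>p * q\<close> is the block determinant. Block operations then leave
  one representative for each rank and outer pair, and mixed steps connect these.\<close>

lemma reach_degenerate:
  assumes "pfaffian a = 0" "a \<noteq> 0"
  shows "reach transvections a (1, 0, 0, 0, 0, 0)"
proof -
  let ?R = "\<lambda>a. reach transvections a (1, 0, 0, 0, 0, 0)"
  note step = block_step[OF block_subset] mixed_step
  note rk1 = reach_rank_one[OF block_subset]
  have r1: "?R (1, 0, 0, 0, 0, 0)" by (rule reach_refl)
  have r2: "?R (1, 1, 0, 0, 0, 0)" using step(5)[of 1 1 0 0 0 0] r1 by simp
  have r3: "?R (0, 1, 0, 0, 0, 0)" using step(6)[of 0 1 0 0 0 0] r2 by simp
  have "?R (0, 0, 0, 0, 1, 0)" by (rule rk1[OF r3]) (simp_all add: zero_prod_def)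
  then have r4: "?R (0, 0, 0, 0, 1, 1)" using step(5)[of 0 0 0 0 1 1] by simp
  then have "?R (0, 0, 0, 1, 1, 1)" using step(4)[of 0 0 0 1 1 1] by simp
  then have "?R (0, 0, 0, 1, 0, 1)" using step(3)[of 0 0 0 1 0 1] by simp
  then have "?R (0, 1, 0, 1, 0, 1)" using step(2)[of 0 1 1 0 0 1] step(2)[of 0 1 0 1 0 1] by simp
  then have r5: "?R (0, 1, 0, 0, 0, 1)" using step(1)[of 0 1 0 0 0 1] by simp
  then have r6: "?R (1, 1, 0, 0, 1, 1)" using step(6)[of 1 1 0 0 1 1] by simp
  have r7: "?R (0, 0, 0, 0, 0, 1)" using step(6)[of 0 0 0 0 0 1] r4 by simp
  obtain p b c d e q where a: "a = (p, b, c, d, e, q)" by (cases a)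
  consider "(b, c, d, e) = 0" | "(b, c, d, e) \<noteq> 0" "b * e + c * d = 0" | "b * e + c * d = 1"
    by (cases "b * e + c * d") auto
  then show ?thesis
  proof cases
    case 1
    then show ?thesis using assms r1 r7 unfolding a by (cases p; cases q) (simp_all add: zero_prod_def)
  next
    case 2
    have "?R (p, 1, 0, 0, 0, q)"
      using assms(1) 2 r2 r3 r5 unfolding a by (cases p; cases q) (simp_all add: add.assoc)
    then show ?thesis unfolding a by (rule rk1) (use 2 in auto)
  next
    case 3
    then have "p = 1" "q = 1" using assms(1) unfolding a by (cases p; cases q; simp add: add.assoc)+
    then show ?thesis using reach_rank_two[OF block_subset _ 3, of 1 1] r6 unfolding a by simp
  qed
qed

text \<open>Transitivity off the quadric. Here block rank at most one forces
  \<open>p = q = 1\<close>, while rank two forces \<open>p * q = 0\<close>; five representatives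
  remain.\<close>

lemma reach_nondegenerate:
  assumes "pfaffian a = 1"
  shows "reach transvections a (1, 0, 0, 0, 0, 1)"
proof -
  let ?R = "\<lambda>a. reach transvections a (1, 0, 0, 0, 0, 1)"
  note step = mixed_step
  note rk1 = reach_rank_one[OF block_subset]
  have r1: "?R (1, 0, 0, 0, 0, 1)" by (rule reach_refl)
  have r2: "?R (1, 1, 0, 0, 0, 1)" using step(1)[of 1 1 0 0 0 1] r1 by simp
  have "?R (1, 0, 0, 0, 1, 1)" by (rule rk1[OF r2]) (simp_all add: zero_prod_def)
  then have r3: "?R (1, 1, 0, 0, 1, 0)" using step(1)[of 1 1 0 0 1 0] by simp
  then have r4: "?R (0, 1, 0, 0, 1, 0)" using step(2)[of 0 1 0 0 1 0] by simp
  then have r5: "?R (0, 1, 0, 0, 1, 1)" using step(1)[of 0 1 0 0 1 1] by simp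
  obtain p b c d e q where a: "a = (p, b, c, d, e, q)" by (cases a)
  consider "(b, c, d, e) = 0" | "(b, c, d, e) \<noteq> 0" "b * e + c * d = 0" | "b * e + c * d = 1"
    by (cases "b * e + c * d") auto
  then show ?thesis
  proof cases
    case 1
    then show ?thesis using assms r1 unfolding a by (cases p; cases q) (simp_all add: zero_prod_def)
  next
    case 2
    then have "p = 1" "q = 1" using assms unfolding a by (cases p; cases q; simp add: add.assoc)+
    then show ?thesis using rk1[OF r2 2(2,1)] unfolding a by simp
  next
    case 3
    then have "?R (p, 1, 0, 0, 1, q)"
      using assms r3 r4 r5 unfolding a by (cases p; cases q) (simp_all add: add.assoc)
    then show ?thesis unfolding a by (rule reach_rank_two[OF block_subset _ 3])
  qed
qed

text \<open>Lets a second form of a space be normalised without disturbing the first one.\<close>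

lemma block_moves_fix:
  assumes "g \<in> moves block_transvections"
  shows "g (p, 0, 0, 0, 0, q) = (p, 0, 0, 0, 0, q)"
  using assms by induction (auto simp: block_transvections_def)

section \<open>Weights of cosets of quadratic functions\<close>

lemma weight_permute_vec:
  assumes "v \<in> carrier_vec n" "p permutes {..<n}"
  shows "weight (permute_vec p v) = weight v"
proof -
  have "int (weight (permute_vec p v)) = (\<Sum>i<n. bint (v $ p i))"
    using assms(1) by (subst weight_eq_sum[of _ n]) (auto simp: permute_vec_def)
  also have "\<dots> = (\<Sum>i<n. bint (v $ i))"
    using sum.permute[OF assms(2), of "\<lambda>i. bint (v $ i)"] by (simp add: o_def)
  finally show ?thesis using assms(1) by (simp add: weight_eq_sum[of _ n, symmetric])
qed

lemma code_equivalent_weights: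
  assumes "code_equivalent n C D"
  shows "weight ` C = weight ` D"
proof -
  obtain p where "C \<subseteq> carrier_vec n" "p permutes {..<n}" "D = permute_vec p ` C"
    using assms unfolding code_equivalent_def by blast
  then show ?thesis using weight_permute_vec by (auto simp: image_image intro!: image_cong)
qed

lemma weight_le: "weight v \<le> dim_vec v"
proof -
  have "weight v \<le> card {..<dim_vec v}"
    unfolding weight_def by (intro card_mono) auto
  then show ?thesis by simp
qed

lemma weight_dist_support:
  assumes "C \<subseteq> carrier_vec n"
  shows "{i \<in> {0..n}. weight_dist C i \<noteq> 0} = weight ` C"
proof -
  have "finite C" using assms finite_carrier_vec_bit by (rule finite_subset)
  then have "weight_dist C i \<noteq> 0 \<longleftrightarrow> i \<in> weight ` C" for i
    by (auto simp: weight_dist_def card_eq_0_iff)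
  moreover have "weight v \<le> n" if "v \<in> C" for v
    using that assms weight_le[of v] by auto
  ultimately show ?thesis by auto
qed

lemma weight_quad_affine:
  "int (weight (quad_vec a + affine_vec 4 c l)) =
     (\<Sum>i<16. bint (quad a i + (c + (\<Sum>t<4. l t * coord t i))))"
proof -
  have "quad_vec a + affine_vec 4 c l \<in> carrier_vec 16"
    by (simp add: quad_vec_def affine_vec_def)
  from weight_eq_sum[OF this] show ?thesis by (simp add: quad_vec_def affine_vec_def)
qed

lemma weight_in_cosets:
  fixes c :: bit and l :: "nat \<Rightarrow> bit"
  shows "weight (quad_vec 0 + affine_vec 4 c l) \<in> {0, 8, 16}" (is ?A)
    "weight (quad_vec (1, 0, 0, 0, 0, 0) + affine_vec 4 c l) \<in> {4, 8, 12}" (is ?B)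
    "weight (quad_vec (1, 0, 0, 0, 0, 1) + affine_vec 4 c l) \<in> {6, 10}" (is ?C)
proof -
  note ev = sum_lessThan_16 sum_lessThan_4 coord_def bit_iff_odd
  have "int (weight (quad_vec 0 + affine_vec 4 c l)) \<in> {0, 8, 16}"
    unfolding weight_quad_affine
    by (cases c; cases "l 0"; cases "l 1"; cases "l 2"; cases "l 3") (simp_all add: ev zero_prod_def)
  then show ?A by auto
  have "int (weight (quad_vec (1, 0, 0, 0, 0, 0) + affine_vec 4 c l)) \<in> {4, 8, 12}"
    unfolding weight_quad_affine
    by (cases c; cases "l 0"; cases "l 1"; cases "l 2"; cases "l 3") (simp_all add: ev)
  then show ?B by auto
  have "int (weight (quad_vec (1, 0, 0, 0, 0, 1) + affine_vec 4 c l)) \<in> {6, 10}"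
    unfolding weight_quad_affine
    by (cases c; cases "l 0"; cases "l 1"; cases "l 2"; cases "l 3") (simp_all add: ev)
  then show ?C by auto
qed

lemma code_of_singleton: "code_of {a} = {quad_vec a + affine_vec 4 c l | c l. True}"
  unfolding code_of_def reed_muller1_eq_affine by blast

lemma weights_code_of_canonical:
  "weight ` code_of {0} = {0, 8, 16}"
  "weight ` code_of {(1, 0, 0, 0, 0, 0)} = {4, 8, 12}"
  "weight ` code_of {(1, 0, 0, 0, 0, 1)} = {6, 10}"
proof -
  note ev = sum_lessThan_16 sum_lessThan_4 coord_def bit_iff_odd zero_prod_def
  have I: "n \<in> weight ` code_of {a}" if "weight (quad_vec a + affine_vec 4 c l) = n" for n a c l
    unfolding code_of_singleton using that by blast
  have W: "weight (quad_vec a + affine_vec 4 c l) = nat (\<Sum>i<16. bint (quad a i + (c + (\<Sum>t<4. l t * coord t i))))"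
    for a c l
    using weight_quad_affine[of a c l] by linarith
  \<comment> \<open>Adding \<open>x2\<close>, a variable absent from both 0 and
    \<open>x0 x1\<close>, yields a balanced word and so realises weight 8.\<close>
  let ?z = "\<lambda>_::nat. 0::bit" and ?x = "\<lambda>t::nat. of_bool (t = 2) :: bit"
  have "0 \<in> weight ` code_of {0}" by (rule I[of 0 0 ?z]) (simp add: W ev)
  moreover have "16 \<in> weight ` code_of {0}" by (rule I[of 0 1 ?z]) (simp add: W ev)
  moreover have "8 \<in> weight ` code_of {0}" by (rule I[of 0 0 ?x]) (simp add: W ev)
  moreover have "weight ` code_of {0} \<subseteq> {0, 8, 16}"
    unfolding code_of_singleton
    by (intro image_subsetI) (elim CollectE exE conjE, simp only: weight_in_cosets(1))
  ultimately show "weight ` code_of {0} = {0, 8, 16}" by blast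
  let ?a = "(1, 0, 0, 0, 0, 0) :: form"
  have "4 \<in> weight ` code_of {?a}" by (rule I[of ?a 0 ?z]) (simp add: W ev)
  moreover have "12 \<in> weight ` code_of {?a}" by (rule I[of ?a 1 ?z]) (simp add: W ev)
  moreover have "8 \<in> weight ` code_of {?a}" by (rule I[of ?a 0 ?x]) (simp add: W ev)
  moreover have "weight ` code_of {?a} \<subseteq> {4, 8, 12}"
    unfolding code_of_singleton
    by (intro image_subsetI) (elim CollectE exE conjE, simp only: weight_in_cosets(2))
  ultimately show "weight ` code_of {?a} = {4, 8, 12}" by blast
  let ?a = "(1, 0, 0, 0, 0, 1) :: form"
  have "6 \<in> weight ` code_of {?a}" by (rule I[of ?a 0 ?z]) (simp add: W ev)
  moreover have "10 \<in> weight ` code_of {?a}" by (rule I[of ?a 1 ?z]) (simp add: W ev)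
  moreover have "weight ` code_of {?a} \<subseteq> {6, 10}"
    unfolding code_of_singleton
    by (intro image_subsetI) (elim CollectE exE conjE, simp only: weight_in_cosets(3))
  ultimately show "weight ` code_of {?a} = {6, 10}" by blast
qed

text \<open>Equivalence preserves weights, so transitivity of the moves reduces every coset to one
  of the representatives 0, \<open>x0 x1\<close> and \<open>x0 x1 + x2 x3\<close>.\<close>

lemma weights_code_of_singleton:
  "weight ` code_of {a} = (if a = 0 then {0, 8, 16} else if pfaffian a = 0 then {4, 8, 12} else {6, 10})"
proof -
  have *: "weight ` code_of {a} = weight ` code_of {b}" if "reach transvections a b" for b
    using that moves_props(4)[of _ transvections "{a}"] unfolding reach_def
    by (auto intro!: code_equivalent_weights)
  show ?thesis
    using *[OF reach_degenerate[of a]] *[OF reach_nondegenerate[of a]] weights_code_of_canonical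
    by (auto simp del: pfaffian.simps)
qed

lemma weights_code_of: "weight ` code_of U = (\<Union>a\<in>U. weight ` code_of {a})"
  unfolding code_of_def by blast

section \<open>Codes built from spaces of forms\<close>

definition form_space :: "form set \<Rightarrow> bool" where
  "form_space U \<longleftrightarrow> 0 \<in> U \<and> (\<forall>a\<in>U. \<forall>b\<in>U. a + b \<in> U)"

lemma form_add_self [simp]: "a + a = (0 :: form)"
  by (cases a) (simp add: zero_prod_def)

text \<open>\<open>hessian\<close> recovers the quadratic part of a word and thereby its affine
  part; the factor 32 is the size of RM(1,4).\<close>

lemma card_code_of: "card (code_of U) = 32 * card U"
proof -
  have "inj_on (\<lambda>(a, r). quad_vec a + r) (U \<times> reed_muller1 4)"
  proof (rule inj_onI)
    fix x y assume xy: "x \<in> U \<times> reed_muller1 4" "y \<in> U \<times> reed_muller1 4"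
      "(case x of (a, r) \<Rightarrow> quad_vec a + r) = (case y of (a, r) \<Rightarrow> quad_vec a + r)"
    obtain a r b s where ars: "x = (a, r)" "y = (b, s)" by (meson surj_pair)
    then have rs: "r \<in> reed_muller1 4" "s \<in> reed_muller1 4" and eq: "quad_vec a + r = quad_vec b + s"
      using xy by auto
    have "hessian (quad_vec c + t) = c" if "t \<in> reed_muller1 4" for c t
      using that by (simp add: hessian_add reed_muller1_4_carrier hessian_quad_vec hessian_reed_muller1)
    then have ab: "a = b" using rs eq by metis
    have "r $ i = s $ i" if "i < 16" for i
    proof -
      have "(quad_vec a + r) $ i = (quad_vec a + s) $ i" using eq ab by simp
      then show ?thesis using that rs[THEN reed_muller1_4_carrier] by simp
    qed
    then have "r = s" using rs[THEN reed_muller1_4_carrier] by (intro eq_vecI) auto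
    then show "x = y" using ab ars by simp
  qed
  moreover have "code_of U = (\<lambda>(a, r). quad_vec a + r) ` (U \<times> reed_muller1 4)"
    unfolding code_of_def by force
  ultimately show ?thesis by (simp add: card_image card_cartesian_product card_reed_muller1)
qed

lemma reed_muller1_subset_code_of: "0 \<in> U \<Longrightarrow> reed_muller1 4 \<subseteq> code_of U"
proof
  fix r assume "0 \<in> U" "r \<in> reed_muller1 4"
  moreover have "r = quad_vec 0 + r"
    using reed_muller1_4_carrier[OF \<open>r \<in> reed_muller1 4\<close>] by (auto simp: quad_vec_def zero_prod_def)
  ultimately show "r \<in> code_of U" unfolding code_of_def by blast
qed

lemma code_of_add:
  assumes "form_space U" "u \<in> code_of U" "v \<in> code_of U"
  shows "u + v \<in> code_of U"
proof -
  obtain a r b s where ab: "a \<in> U" "b \<in> U" and rs: "r \<in> reed_muller1 4" "s \<in> reed_muller1 4"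
    and uv: "u = quad_vec a + r" "v = quad_vec b + s"
    using assms(2,3) unfolding code_of_def by blast
  have "u + v = (quad_vec a + quad_vec b) + (r + s)"
    using rs[THEN reed_muller1_4_carrier] unfolding uv by (intro eq_vecI) (auto simp: quad_vec_def add_ac)
  then show ?thesis
    using ab reed_muller1_add[OF rs] assms(1) unfolding code_of_def quad_vec_add form_space_def by blast
qed

text \<open>The zero form contributes the weights 0, 8, 16, and every other form contributes 4, 8,
  12 or 6, 10 according to its Pfaffian; so \<open>a\<close> is 4 or 2. The summand 5 is the
  dimension of RM(1,4).\<close>

lemma admissible_code_of:
  assumes U: "form_space U" "card U = 2 ^ j" "U \<noteq> {0}"
    and pf: "(\<forall>a\<in>U. pfaffian a = 0) \<or> (\<forall>a\<in>U - {0}. pfaffian a = 1)"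
  shows "admissible (5 + j) (code_of U)"
proof -
  have zero: "0 \<in> U" using U(1) by (simp add: form_space_def)
  obtain b where b: "b \<in> U" "b \<noteq> 0" using U(3) zero by blast
  have RM: "reed_muller1 4 \<subseteq> code_of U" using reed_muller1_subset_code_of[OF zero] .
  have "binary_code 16 (5 + j) (code_of U)"
    unfolding binary_code_iff using code_of_carrier code_of_add[OF U(1)] RM zero_in_reed_muller1[of 4]
    by (auto simp: card_code_of U(2) power_add)
  moreover have "\<exists>a. 0 < a \<and> a < 8 \<and> weight ` code_of U = {0, 8 - a, 8, 8 + a, 16}"
  proof -
    have split: "weight ` code_of U = {0, 8, 16} \<union> (\<Union>a\<in>U - {0}. weight ` code_of {a})"
    proof -
      have "(\<Union>a\<in>U. F a) = F 0 \<union> (\<Union>a\<in>U - {0}. F a)" for F :: "form \<Rightarrow> nat set"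
        using zero by blast
      then show ?thesis unfolding weights_code_of[of U] by (simp only: weights_code_of_canonical(1))
    qed
    show ?thesis using pf
    proof
      assume "\<forall>a\<in>U. pfaffian a = 0"
      then have "weight ` code_of {a} = {4, 8, 12}" if "a \<in> U - {0}" for a
        using that by (simp add: weights_code_of_singleton)
      then have "(\<Union>a\<in>U - {0}. weight ` code_of {a}) = {4, 8, 12}" using b by blast
      then have "weight ` code_of U = {0, 4, 8, 12, 16}"
        unfolding split by auto
      then show ?thesis by (intro exI[of _ 4]) simp
    next
      assume "\<forall>a\<in>U - {0}. pfaffian a = 1"
      then have "weight ` code_of {a} = {6, 10}" if "a \<in> U - {0}" for a
        using that by (simp add: weights_code_of_singleton)
      then have "(\<Union>a\<in>U - {0}. weight ` code_of {a}) = {6, 10}" using b by blast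
      then have "weight ` code_of U = {0, 6, 8, 10, 16}"
        unfolding split by auto
      then show ?thesis by (intro exI[of _ 2]) auto
    qed
  qed
  ultimately show ?thesis
    unfolding admissible_def weight_dist_support[OF code_of_carrier] using RM by blast
qed

lemma coord_separates:
  assumes "i < 16" "j < 16" "i \<noteq> j"
  shows "\<exists>t<4. coord t i \<noteq> coord t j"
proof (rule ccontr)
  assume "\<not> (\<exists>t<4. coord t i \<noteq> coord t j)"
  then have eq: "bit i t = bit j t" if "t < 4" for t
    using that by (auto simp: coord_def)
  have "bit i t = bit j t" for t
  proof (cases "t < 4")
    case False
    then have "(2::nat) ^ 4 \<le> 2 ^ t" by (intro power_increasing) auto
    then have "coord t i = 0" "coord t j = 0" using assms by (auto intro: coord_lt)
    then show ?thesis by (simp add: coord_def)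
  qed (rule eq)
  then show False using assms(3) by (auto intro: bit_eqI)
qed

text \<open>The coordinate functions separate positions, so Parseval's identity applies with total
  \<open>16 * 32\<close>; halving the deviations divides it by 4.\<close>

lemma sum_weight_deviation_reed_muller1:
  assumes "f \<in> carrier_vec 16"
  shows "(\<Sum>r\<in>reed_muller1 4. (8 - int (weight (f + r)))\<^sup>2) = 128"
proof -
  have "\<exists>g\<in>reed_muller1 4. g $ i \<noteq> g $ j" if ij: "i < 16" "j < 16" "i \<noteq> j" for i j
  proof -
    obtain t where t: "t < 4" "coord t i \<noteq> coord t j" using coord_separates[OF ij] by blast
    have "affine_vec 4 0 (\<lambda>s. of_bool (s = t)) $ k = coord t k" if "k < 16" for k
      using that t(1) by (simp add: affine_vec_def of_bool_def if_distrib[of "\<lambda>x. x * _"] cong: if_cong)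
    then show ?thesis using t(2) ij affine_vec_in_reed_muller1 by metis
  qed
  then have "(\<Sum>r\<in>reed_muller1 4. (int 16 - 2 * int (weight (f + r)))\<^sup>2) = int 16 * int (card (reed_muller1 4))"
    using assms reed_muller1_4_carrier reed_muller1_add finite_reed_muller1
    by (intro sum_squared_weight_deviation) auto
  moreover have "(int 16 - 2 * int w)\<^sup>2 = 4 * (8 - int w)\<^sup>2" for w
    by (simp add: power2_eq_square algebra_simps)
  ultimately have "4 * (\<Sum>r\<in>reed_muller1 4. (8 - int (weight (f + r)))\<^sup>2) = 4 * 128"
    by (simp add: card_reed_muller1 sum_distrib_left)
  then show ?thesis by simp
qed

section \<open>Admissible codes as spaces of forms\<close>

text \<open>Only constant words have these weights. Words outside RM(1,4) are thereby confined to
  the three middle weights.\<close>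

lemma extreme_weight_in_reed_muller1:
  assumes v: "v \<in> carrier_vec 16" and w: "weight v \<in> {0, 16}"
  shows "v \<in> reed_muller1 4"
proof -
  let ?S = "{i. i < 16 \<and> v $ i \<noteq> 0}"
  have card: "card ?S = weight v" using v by (simp add: weight_def)
  have "?S = {} \<or> ?S = {..<16}"
    using w
  proof (elim insertE emptyE)
    assume "weight v = 0"
    moreover have "finite ?S" by simp
    ultimately have "?S = {}" using card by (metis card_0_eq)
    then show ?thesis by blast
  next
    assume "weight v = 16"
    then have "?S = {..<16}" using card by (intro card_subset_eq) auto
    then show ?thesis by blast
  qed
  then obtain c where c: "\<forall>i<16. v $ i = c"
  proof
    assume "?S = {}"
    then have "\<forall>i<16. v $ i = 0" by blast
    then show ?thesis by (rule that)
  next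
    assume "?S = {..<16}"
    then have "\<forall>i<16. v $ i = 1" by auto
    then show ?thesis by (rule that)
  qed
  then have "v = affine_vec 4 c (\<lambda>_. 0)" using v by (auto simp: affine_vec_def)
  then show ?thesis by (simp add: affine_vec_in_reed_muller1)
qed

lemma code_of_zero: "code_of {0} = reed_muller1 4"
proof (rule card_subset_eq[symmetric])
  show "finite (code_of {0})"
    using code_of_carrier finite_carrier_vec_bit by (rule finite_subset)
  show "reed_muller1 4 \<subseteq> code_of {0}" by (rule reed_muller1_subset_code_of) simp
  show "card (reed_muller1 4) = card (code_of {0})" by (simp add: card_code_of card_reed_muller1)
qed

lemma vec_add_add_self:
  fixes u v :: "bit vec"
  assumes "u \<in> carrier_vec n" "v \<in> carrier_vec n"
  shows "(u + v) + v = u"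
  using assms by (intro eq_vecI) (auto simp: add.assoc)

lemma admissible_orthogonal:
  assumes C: "C \<subseteq> carrier_vec 16" "\<And>u v. u \<in> C \<Longrightarrow> v \<in> C \<Longrightarrow> u + v \<in> C" "reed_muller1 4 \<subseteq> C"
    and a: "0 < a" "a < 8" and W: "weight ` C = {0, 8 - a, 8, 8 + a, 16}"
    and f: "f \<in> C" "f \<notin> reed_muller1 4" and r: "r \<in> reed_muller1 4"
  shows "(\<Sum>i<16. f $ i * r $ i) = 0"
proof -
  let ?R = "reed_muller1 4"
  have fc: "f \<in> carrier_vec 16" using f C by blast
  have wt: "weight (f + r) \<in> {8 - a, 8, 8 + a}" if r: "r \<in> ?R" for r
  proof -
    have "f + r \<in> C" using C(2,3) f(1) r by blast
    moreover have "f + r \<notin> ?R"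
      using reed_muller1_add[OF _ r, of "f + r"] vec_add_add_self[OF fc reed_muller1_4_carrier[OF r]] f(2) by auto
    ultimately have "weight (f + r) \<in> {0, 8 - a, 8, 8 + a, 16}" "weight (f + r) \<notin> {0, 16}"
      using W C(1) extreme_weight_in_reed_muller1[of "f + r"] by blast+
    then show ?thesis by blast
  qed
  \<comment> \<open>Each of these words contributes the square of \<open>a\<close> to the Parseval
    sum, the others nothing. With at most 32 words and total 128, only \<open>a = 2\<close> (all 32
    words) and \<open>a = 4\<close> are possible.\<close>
  let ?N = "{r \<in> ?R. weight (f + r) \<noteq> 8}"
  have "(8 - int (weight (f + r)))\<^sup>2 = (if weight (f + r) \<noteq> 8 then (int a)\<^sup>2 else 0)" if "r \<in> ?R" for r
    using wt[OF that] a by (auto simp: of_nat_diff)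
  then have "128 = (\<Sum>r\<in>?R. if weight (f + r) \<noteq> 8 then (int a)\<^sup>2 else 0)"
    using sum_weight_deviation_reed_muller1[OF fc] by simp
  also have "\<dots> = int (card ?N) * (int a)\<^sup>2"
    using finite_reed_muller1[of 4] by (simp add: sum.inter_filter[symmetric])
  finally have N: "int (card ?N) * (int a)\<^sup>2 = 128" by simp
  have "int (card ?N * (a * a)) = int 128" using N by (simp add: power2_eq_square)
  then have N: "card ?N * (a * a) = 128" by (simp only: of_nat_eq_iff)
  have N_le: "card ?N \<le> 32"
    using card_mono[of ?R ?N] finite_reed_muller1[of 4] by (simp add: card_reed_muller1)
  consider "a = 1" | "a = 2" | "a = 3" | "a = 4" | "a = 5" | "a = 6" | "a = 7"
    using a by linarith
  then consider "a = 2" "card ?N = card ?R" | "a = 4"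
  proof cases
    case 1
    with N N_le have False by simp
    then show ?thesis ..
  next
    case 3
    with N have False by (simp, presburger?)
    then show ?thesis ..
  next
    case 5
    with N have False by (simp, presburger?)
    then show ?thesis ..
  next
    case 6
    with N have False by (simp, presburger?)
    then show ?thesis ..
  next
    case 7
    with N have False by (simp, presburger?)
    then show ?thesis ..
  next
    case 2
    with N have "card ?N = card ?R" by (simp add: card_reed_muller1)
    then show ?thesis using 2 that by blast
  qed (use that in blast)
  then have mod4: "\<exists>m. \<forall>r\<in>?R. weight (f + r) mod 4 = m"
  proof cases
    case 1
    have "?N = ?R" by (rule card_subset_eq) (use finite_reed_muller1[of 4] 1(2) in auto)
    then have "weight (f + r) \<in> {6, 10}" if "r \<in> ?R" for r
      using that wt[OF that] 1(1) by auto
    then show ?thesis by (intro exI[of _ 2]) fastforce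
  next
    case 2
    then have "weight (f + r) \<in> {4, 8, 12}" if "r \<in> ?R" for r
      using wt[OF that] by auto
    then show ?thesis by (intro exI[of _ 0]) fastforce
  qed
  \<comment> \<open>Taking the zero word identifies the common residue with that of \<open>f\<close>
    itself. Since weights in RM(1,4) are divisible by 4, twice the overlap of \<open>f\<close> and
    \<open>r\<close> is divisible by 4, so the overlap is even.\<close>
  have "f + 0\<^sub>v 16 = f" using fc by simp
  then have "weight (f + r) mod 4 = weight f mod 4"
    using mod4 r zero_in_reed_muller1[of 4] by fastforce
  moreover have "weight r mod 4 = 0"
  proof -
    have "weight r \<in> weight ` code_of {0}" using r by (auto simp: code_of_zero)
    then show ?thesis unfolding weights_code_of_canonical by auto
  qed
  moreover have "int (weight (f + r)) = int (weight f) + int (weight r) - 2 * (\<Sum>i<16. bint (f $ i * r $ i))"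
    by (rule weight_add[OF fc reed_muller1_4_carrier[OF r]])
  ultimately have "even (\<Sum>i<16. bint (f $ i * r $ i))" by presburger
  then show ?thesis by (simp only: even_sum_bint)
qed

lemma admissible_imp_form_space:
  assumes "admissible k C"
  obtains U where "form_space U" "C = code_of U" "U \<noteq> {0}"
    "(\<forall>u\<in>U. pfaffian u = 0) \<or> (\<forall>u\<in>U - {0}. pfaffian u = 1)"
proof -
  have C: "C \<subseteq> carrier_vec 16" and add: "\<And>u v. u \<in> C \<Longrightarrow> v \<in> C \<Longrightarrow> u + v \<in> C"
    and RM: "reed_muller1 4 \<subseteq> C"
    using assms by (auto simp: admissible_def binary_code_iff)
  obtain a where a: "0 < a" "a < 8" and W: "weight ` C = {0, 8 - a, 8, 8 + a, 16}"
    using assms unfolding admissible_def weight_dist_support[OF C] by blast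
  define U where "U = {h. quad_vec h \<in> C}"
  have quad0: "quad_vec 0 + r = r" if "r \<in> reed_muller1 4" for r
    using reed_muller1_4_carrier[OF that] by (auto simp: quad_vec_def zero_prod_def)
  have ex: "\<exists>h. \<exists>r\<in>reed_muller1 4. f = quad_vec h + r" if f: "f \<in> C" for f
  proof (cases "f \<in> reed_muller1 4")
    case True
    then show ?thesis using quad0 by metis
  next
    case False
    then show ?thesis
      using orthogonal_reed_muller1[of f] admissible_orthogonal[OF C add RM a W f] f C by blast
  qed
  have CU: "C = code_of U"
  proof (intro equalityI subsetI)
    fix f assume f: "f \<in> C"
    then obtain h r where hr: "r \<in> reed_muller1 4" "f = quad_vec h + r" using ex by blast
    then have "quad_vec h = f + r" using vec_add_add_self[OF quad_vec_carrier reed_muller1_4_carrier] by metis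
    moreover have "f + r \<in> C" using add f hr(1) RM by blast
    ultimately have "h \<in> U" unfolding U_def by simp
    then show "f \<in> code_of U" using hr unfolding code_of_def by blast
  next
    fix f assume "f \<in> code_of U"
    then show "f \<in> C" using add RM unfolding code_of_def U_def by blast
  qed
  have "quad_vec 0 \<in> C"
  proof -
    have "quad_vec 0 = 0\<^sub>v 16" by (auto simp: quad_vec_def zero_prod_def)
    then show ?thesis using zero_in_reed_muller1[of 4] RM by auto
  qed
  then have "form_space U" using add by (auto simp: form_space_def U_def quad_vec_add[symmetric])
  moreover have "U \<noteq> {0}"
  proof
    assume "U = {0}"
    then have "{0, 8 - a, 8, 8 + a, 16} = {0, 8, 16 :: nat}"
      using W CU weights_code_of_canonical(1) by metis
    then have "8 - a \<in> {0, 8, 16}" by blast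
    then show False using a by auto
  qed
  moreover have "(\<forall>u\<in>U. pfaffian u = 0) \<or> (\<forall>u\<in>U - {0}. pfaffian u = 1)"
  proof (rule ccontr)
    assume "\<not> ?thesis"
    then obtain u v where "u \<in> U" "pfaffian u \<noteq> 0" "v \<in> U - {0}" "pfaffian v \<noteq> 1"
      by blast
    then have uv: "u \<in> U" "pfaffian u = 1" "v \<in> U" "v \<noteq> 0" "pfaffian v = 0"
      unfolding bit_not_zero_iff bit_not_one_iff by blast+
    have "pfaffian 0 = 0" by (simp add: zero_prod_def)
    then have "u \<noteq> 0" using uv(2) by auto
    \<comment> \<open>Both 6 and 4 would have to equal \<open>8 - a\<close>.\<close>
    then have "6 \<in> weight ` code_of {u}" "4 \<in> weight ` code_of {v}"
      using uv by (simp_all add: weights_code_of_singleton del: pfaffian.simps)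
    then have "6 \<in> weight ` C" "4 \<in> weight ` C"
      unfolding CU weights_code_of[of U] using uv by blast+
    then show False using a unfolding W by auto
  qed
  ultimately show ?thesis using CU that by blast
qed

section \<open>Normal forms\<close>

definition pencil1 :: "form set" where "pencil1 = {(a, 0, 0, 0, 0, 0) | a. True}"
definition pencil2 :: "form set" where "pencil2 = {(a, b, 0, 0, 0, 0) | a b. True}"
text \<open>The multiples of \<open>x0\<close> by linear functions of the other variables: a plane
  of the Klein quadric consisting of the lines through a point.\<close>

definition star3 :: "form set" where "star3 = {(a, b, c, 0, 0, 0) | a b c. True}"
text \<open>The forms in \<open>x0, x1, x2\<close> alone: a plane of the other family on the Klein
  quadric.\<close>

definition plane3 :: "form set" where "plane3 = {(a, b, 0, d, 0, 0) | a b d. True}"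
definition bent1 :: "form set" where "bent1 = {(a, 0, 0, 0, 0, a) | a. True}"
text \<open>On this space the Pfaffian is \<open>a^2 + a b + b^2\<close>, the norm form of the field
  with four elements, which vanishes only at zero.\<close>

definition bent2 :: "form set" where "bent2 = {(a + b, b, 0, 0, b, a) | a b. True}"

lemmas normal_form_defs = pencil1_def pencil2_def star3_def plane3_def bent1_def bent2_def

lemma form_space_image:
  assumes "g \<in> moves ts" "set ts \<subseteq> set transvections" "form_space U"
  shows "form_space (g ` U)"
proof -
  have add: "g (a + b) = g a + g b" for a b by (rule moves_props(1)[OF assms(1,2)])
  have "g 0 = g 0 + g 0" using add[of 0 0] by simp
  then have "g 0 = 0" by simp
  then show ?thesis using assms(3) unfolding form_space_def by (auto simp: add[symmetric] intro: image_eqI)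
qed

lemma move_into:
  assumes "set ts \<subseteq> set transvections" "form_space U" "a \<in> U" "reach ts a b"
  obtains g where "g \<in> moves ts" "form_space (g ` U)" "b \<in> g ` U"
    "code_equivalent 16 (code_of U) (code_of (g ` U))"
  using assms form_space_image moves_props(4)[OF _ assms(1)] unfolding reach_def by blast

text \<open>Forms are normalised one at a time, the first to \<open>x0 x1\<close>, the second to
  \<open>x0 x2\<close> up to a multiple of the first. Vanishing of the Pfaffian on sums then
  confines any further form to the direction \<open>x0 x3\<close> or \<open>x1 x2\<close>, never
  both.\<close>

lemma degenerate_normal_form:
  assumes U: "form_space U" "U \<noteq> {0}" and pf: "\<forall>u\<in>U. pfaffian u = 0"
  shows "\<exists>V\<in>{pencil1, pencil2, star3, plane3}. code_equivalent 16 (code_of U) (code_of V)"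
proof -
  obtain u where u: "u \<in> U" "u \<noteq> 0" using U unfolding form_space_def by blast
  have "reach transvections u (1, 0, 0, 0, 0, 0)" using reach_degenerate u pf by blast
  from move_into[OF order.refl U(1) u(1) this] obtain g where
    g: "g \<in> moves transvections" and V: "form_space (g ` U)" "(1, 0, 0, 0, 0, 0) \<in> g ` U"
    and eqU: "code_equivalent 16 (code_of U) (code_of (g ` U))" .
  define V where "V = g ` U"
  have pfV: "pfaffian v = 0" if "v \<in> V" for v
    using that pf moves_props(2)[OF g order.refl] unfolding V_def by (auto simp del: pfaffian.simps)
  note V = V[folded V_def] and eqU = eqU[folded V_def]
  have addV: "v + w \<in> V" if "v \<in> V" "w \<in> V" for v w
    using V(1) that unfolding form_space_def by blast
  have p1: "(a, 0, 0, 0, 0, 0) \<in> V" for a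
    using V unfolding form_space_def zero_prod_def by (cases a) auto
  then have sub1: "pencil1 \<subseteq> V" unfolding pencil1_def by blast
  show ?thesis
  proof (cases "V = pencil1")
    case True
    then show ?thesis using eqU by blast
  next
    case False
    then obtain v where v: "v \<in> V" "v \<notin> pencil1" using sub1 by blast
    obtain a b c d e f where abc: "v = (a, b, c, d, e, f)" by (cases v)
    \<comment> \<open>Adding \<open>x0 x1\<close> changes the Pfaffian by exactly
      \<open>f\<close>.\<close>
    have "pfaffian (v + (1, 0, 0, 0, 0, 0)) = 0" using addV[OF v(1) V(2)] by (rule pfV)
    with pfV[OF v(1)] have "a * f + (b * e + c * d) = 0" "(a + 1) * f + (b * e + c * d) = 0"
      unfolding abc by (simp_all add: add.assoc)
    then have f: "f = 0" and bc: "b * e + c * d = 0"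
      by (cases a; cases f; simp)+
    then have "(b, c, d, e) \<noteq> 0" using v(2) unfolding abc pencil1_def zero_prod_def by auto
    then have "reach block_transvections v (a, 1, 0, 0, 0, 0)"
      unfolding abc f using bc by (intro reach_rank_one[OF order.refl reach_refl])
    from move_into[OF block_subset V(1) v(1) this] obtain h where
      h: "h \<in> moves block_transvections" and X: "form_space (h ` V)" "(a, 1, 0, 0, 0, 0) \<in> h ` V"
      and eqV: "code_equivalent 16 (code_of V) (code_of (h ` V))" .
    define X where "X = h ` V"
    note X = X[folded X_def] and eqV = eqV[folded X_def]
    have eqX: "code_equivalent 16 (code_of U) (code_of X)"
      using code_equivalent_trans[OF eqU eqV] .
    have pfX: "pfaffian x = 0" if "x \<in> X" for x
      using that pfV moves_props(2)[OF h block_subset] unfolding X_def by (auto simp del: pfaffian.simps)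
    have addX: "x + y \<in> X" if "x \<in> X" "y \<in> X" for x y
      using X(1) that unfolding form_space_def by blast
    have q1: "(p, 0, 0, 0, 0, 0) \<in> X" for p
      using p1[of p] block_moves_fix[OF h, of p 0] unfolding X_def by (metis image_eqI)
    have q2: "(p, q, 0, 0, 0, 0) \<in> X" for p q
      using q1[of p] addX[OF X(2) q1[of "a + p"]] by (cases q) simp_all
    \<comment> \<open>Adding \<open>x0 x1\<close> isolates \<open>a6\<close>, adding
      \<open>x0 x2\<close> isolates \<open>a5\<close>, and what is left of the Pfaffian is
      \<open>a3 * a4\<close>.\<close>
    have polar: "a6 = 0 \<and> a5 = 0 \<and> a3 * a4 = 0" if "(a1, a2, a3, a4, a5, a6) \<in> X" for a1 a2 a3 a4 a5 a6
      using pfX[OF that] pfX[OF addX[OF that q1[of 1]]] pfX[OF addX[OF that q2[of 0 1]]]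
      by (cases a1; cases a2; cases a3; cases a4; cases a5; cases a6) simp_all
    show ?thesis
    proof (cases "X = pencil2")
      case True
      then show ?thesis using eqX by blast
    next
      case False
      moreover have "pencil2 \<subseteq> X" using q2 unfolding pencil2_def by blast
      ultimately obtain w where w: "w \<in> X" "w \<notin> pencil2" by blast
      obtain a1 a2 a3 a4 a5 a6 where w': "w = (a1, a2, a3, a4, a5, a6)" by (cases w)
      have "a6 = 0" "a5 = 0" "a3 * a4 = 0" using polar w unfolding w' by blast+
      then consider "a3 = 1" "w = (a1, a2, 1, 0, 0, 0)" | "a4 = 1" "w = (a1, a2, 0, 1, 0, 0)"
        using w(2) unfolding w' pencil2_def by (cases a3; cases a4) auto
      then show ?thesis
      proof cases
        case 1
        have q3: "(p, q, r, 0, 0, 0) \<in> X" for p q r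
          using q2[of p q] addX[OF w(1) q2[of "a1 + p" "a2 + q"]] unfolding 1(2) by (cases r) simp_all
        \<comment> \<open>Adding \<open>x0 x3\<close> flips \<open>b3\<close>, so both
          \<open>b3 * b4\<close> and \<open>(b3 + 1) * b4\<close> vanish. The other case exchanges
          the roles of \<open>b3\<close> and \<open>b4\<close>.\<close>
        have "b4 = 0" if "(b1, b2, b3, b4, b5, b6) \<in> X" for b1 b2 b3 b4 b5 b6
          using polar[OF that] polar[of "b1 + 0" "b2 + 0" "b3 + 1" "b4 + 0" "b5 + 0" "b6 + 0"] addX[OF that q3[of 0 0 1]]
          by (cases b4; cases b3) simp_all
        then have "x \<in> star3" if "x \<in> X" for x
          using that polar unfolding star3_def by (cases x) blast
        then have "X = star3" using q3 unfolding star3_def by blast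
        then show ?thesis using eqX by blast
      next
        case 2
        have q3: "(p, q, 0, r, 0, 0) \<in> X" for p q r
          using q2[of p q] addX[OF w(1) q2[of "a1 + p" "a2 + q"]] unfolding 2(2) by (cases r) simp_all
        have "b3 = 0" if "(b1, b2, b3, b4, b5, b6) \<in> X" for b1 b2 b3 b4 b5 b6
          using polar[OF that] polar[of "b1 + 0" "b2 + 0" "b3 + 0" "b4 + 1" "b5 + 0" "b6 + 0"] addX[OF that q3[of 0 0 1]]
          by (cases b4; cases b3) simp_all
        then have "x \<in> plane3" if "x \<in> X" for x
          using that polar unfolding plane3_def by (cases x) blast
        then have "X = plane3" using q3 unfolding plane3_def by blast
        then show ?thesis using eqX by blast
      qed
    qed
  qed
qed

lemma nondegenerate_normal_form:
  assumes U: "form_space U" "U \<noteq> {0}" and pf: "\<forall>u\<in>U - {0}. pfaffian u = 1"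
  shows "\<exists>V\<in>{bent1, bent2}. code_equivalent 16 (code_of U) (code_of V)"
proof -
  have pf_image: "pfaffian v = 1" if "g \<in> moves ts" "set ts \<subseteq> set transvections" "form_space S"
    "\<forall>u\<in>S - {0}. pfaffian u = 1" "v \<in> g ` S" "v \<noteq> 0" for g ts S v
  proof -
    obtain s where s: "s \<in> S" "v = g s" using \<open>v \<in> g ` S\<close> by blast
    have "g 0 = g 0 + g 0" using moves_props(1)[OF that(1,2), of 0 0] by simp
    then have "s \<noteq> 0" using s \<open>v \<noteq> 0\<close> by auto
    then show ?thesis using s that(4) moves_props(2)[OF that(1,2)] by auto
  qed
  obtain u where u: "u \<in> U" "u \<noteq> 0" using U unfolding form_space_def by blast
  have "reach transvections u (1, 0, 0, 0, 0, 1)" using reach_nondegenerate u pf by blast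
  from move_into[OF order.refl U(1) u(1) this] obtain g where
    g: "g \<in> moves transvections" and V: "form_space (g ` U)" "(1, 0, 0, 0, 0, 1) \<in> g ` U"
    and eqU: "code_equivalent 16 (code_of U) (code_of (g ` U))" .
  define V where "V = g ` U"
  note V = V[folded V_def] and eqU = eqU[folded V_def]
  have pfV: "pfaffian v = 1" if "v \<in> V" "v \<noteq> 0" for v
    using pf_image[OF g order.refl U(1) pf] that unfolding V_def by blast
  have addV: "v + w \<in> V" if "v \<in> V" "w \<in> V" for v w
    using V(1) that unfolding form_space_def by blast
  have p1: "(a, 0, 0, 0, 0, a) \<in> V" for a
    using V unfolding form_space_def zero_prod_def by (cases a) auto
  then have sub1: "bent1 \<subseteq> V" unfolding bent1_def by blast
  show ?thesis
  proof (cases "V = bent1")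
    case True
    then show ?thesis using eqU by blast
  next
    case False
    then obtain v where v: "v \<in> V" "v \<notin> bent1" using sub1 by blast
    obtain a b c d e f where abc: "v = (a, b, c, d, e, f)" by (cases v)
    have nz: "v \<noteq> 0" "v + (1, 0, 0, 0, 0, 1) \<noteq> 0"
      using v(2) unfolding abc bent1_def zero_prod_def by (cases a; cases f; auto)+
    have "pfaffian v = 1" "pfaffian (v + (1, 0, 0, 0, 0, 1)) = 1"
      using pfV[OF v(1) nz(1)] pfV[OF addV[OF v(1) V(2)] nz(2)] by blast+
    \<comment> \<open>Equating the two Pfaffians gives \<open>a + f = 1\<close>; hence
      \<open>a * f = 0\<close> and the block has determinant 1.\<close>
    then have af: "a + f = 1" and bc: "b * e + c * d = 1"
      unfolding abc by (cases a; cases f; simp add: add.assoc)+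
    have "reach block_transvections v (a, 1, 0, 0, 1, f)"
      unfolding abc using bc by (intro reach_rank_two[OF order.refl reach_refl])
    from move_into[OF block_subset V(1) v(1) this] obtain h where
      h: "h \<in> moves block_transvections" and X: "form_space (h ` V)" "(a, 1, 0, 0, 1, f) \<in> h ` V"
      and eqV: "code_equivalent 16 (code_of V) (code_of (h ` V))" .
    define X where "X = h ` V"
    note X = X[folded X_def] and eqV = eqV[folded X_def]
    have eqX: "code_equivalent 16 (code_of U) (code_of X)"
      using code_equivalent_trans[OF eqU eqV] .
    have pfX: "pfaffian x = 1" if "x \<in> X" "x \<noteq> 0" for x
      using pf_image[OF h block_subset V(1)] pfV that unfolding X_def by blast
    have addX: "x + y \<in> X" if "x \<in> X" "y \<in> X" for x y
      using X(1) that unfolding form_space_def by blast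
    have q1: "(p, 0, 0, 0, 0, p) \<in> X" for p
      using p1[of p] block_moves_fix[OF h, of p p] unfolding X_def by (metis image_eqI)
    have a: "a = f + 1" using af by (cases a; cases f) simp_all
    have q2: "(p + q, q, 0, 0, q, p) \<in> X" for p q
      using q1[of p] addX[OF X(2) q1[of "f + p"]] unfolding a by (cases q) (simp_all add: add_ac)
    have "x \<in> bent2" if x: "x \<in> X" for x
    proof (rule ccontr)
      assume nx: "x \<notin> bent2"
      have pf4: "pfaffian (x + y) = 1" if "y \<in> bent2" for y
      proof -
        have y: "y \<in> X" using that q2 unfolding bent2_def by blast
        have "x + y \<noteq> 0"
        proof
          assume "x + y = 0"
          then have "(x + y) + y = y" by simp
          then have "x = y" by (simp add: add.assoc)
          then show False using nx that by blast
        qed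
        then show ?thesis using pfX[OF addX[OF x y]] by blast
      qed
      \<comment> \<open>The Pfaffian is quadratic, so its four values on \<open>x + bent2\<close>
        have the same sum as those on \<open>bent2\<close>, namely 0 + 1 + 1 + 1 = 1; but four ones
        sum to 0.\<close>
      have "(0, 0, 0, 0, 0, 0) \<in> bent2" "(1, 0, 0, 0, 0, 1) \<in> bent2"
        "(1, 1, 0, 0, 1, 0) \<in> bent2" "(0, 1, 0, 0, 1, 1) \<in> bent2"
        unfolding bent2_def by (force intro: exI[of _ 0] exI[of _ 1])+
      note pf4[OF this(1)] pf4[OF this(2)] pf4[OF this(3)] pf4[OF this(4)]
      moreover obtain a1 a2 a3 a4 a5 a6 where "x = (a1, a2, a3, a4, a5, a6)" by (cases x)
      ultimately show False
        by (cases a1; cases a2; cases a5; cases a6) simp_all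
    qed
    then have "X = bent2" using q2 unfolding bent2_def by blast
    then show ?thesis using eqX by blast
  qed
qed


section \<open>Admissibility of the six normal forms\<close>

lemma form_space_normal_forms:
  "form_space pencil1" "form_space pencil2" "form_space star3" "form_space plane3"
  "form_space bent1" "form_space bent2"
proof -
  show "form_space pencil1" "form_space pencil2" "form_space star3" "form_space plane3" "form_space bent1"
    unfolding form_space_def normal_form_defs zero_prod_def by auto
  have "(a + b, b, 0, 0, b, a) + (a' + b', b', 0, 0, b', a') \<in> bent2" for a b a' b'
  proof -
    have "(a + b, b, 0, 0, b, a) + (a' + b', b', 0, 0, b', a')
        = (((a + a') + (b + b'), b + b', 0, 0, b + b', a + a') :: form)"
      by (simp add: add_ac)
    then show ?thesis unfolding bent2_def by blast
  qed
  moreover have "0 \<in> bent2"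
    unfolding bent2_def zero_prod_def by (rule CollectI, rule exI[of _ 0], rule exI[of _ 0]) simp
  ultimately show "form_space bent2" unfolding form_space_def by (auto simp: bent2_def)
qed

lemma card_normal_forms:
  "card pencil1 = 2 ^ 1" "card pencil2 = 2 ^ 2" "card star3 = 2 ^ 3" "card plane3 = 2 ^ 3"
  "card bent1 = 2 ^ 1" "card bent2 = 2 ^ 2"
proof -
  have img: "pencil1 = (\<lambda>a. (a, 0, 0, 0, 0, 0)) ` UNIV"
    "pencil2 = (\<lambda>(a, b). (a, b, 0, 0, 0, 0)) ` UNIV"
    "star3 = (\<lambda>(a, b, c). (a, b, c, 0, 0, 0)) ` UNIV"
    "plane3 = (\<lambda>(a, b, d). (a, b, 0, d, 0, 0)) ` UNIV"
    "bent1 = (\<lambda>a. (a, 0, 0, 0, 0, a)) ` UNIV"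
    "bent2 = (\<lambda>(a, b). (a + b, b, 0, 0, b, a)) ` UNIV"
    unfolding normal_form_defs by (auto simp: image_iff split_paired_Ex)
  have c: "card (UNIV :: (bit \<times> bit) set) = 4" "card (UNIV :: (bit \<times> bit \<times> bit) set) = 8"
    unfolding UNIV_Times_UNIV[symmetric] card_cartesian_product card_UNIV_bit by simp_all
  show "card pencil1 = 2 ^ 1" "card pencil2 = 2 ^ 2" "card star3 = 2 ^ 3" "card plane3 = 2 ^ 3"
    "card bent1 = 2 ^ 1" "card bent2 = 2 ^ 2"
    unfolding img by (subst card_image; auto simp: inj_on_def c card_UNIV_bit)+
qed

lemma pfaffian_normal_forms:
  "\<forall>u\<in>pencil1. pfaffian u = 0" "\<forall>u\<in>pencil2. pfaffian u = 0"
  "\<forall>u\<in>star3. pfaffian u = 0" "\<forall>u\<in>plane3. pfaffian u = 0"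
  "\<forall>u\<in>bent1 - {0}. pfaffian u = 1" "\<forall>u\<in>bent2 - {0}. pfaffian u = 1"
proof -
  show "\<forall>u\<in>pencil1. pfaffian u = 0" "\<forall>u\<in>pencil2. pfaffian u = 0"
    "\<forall>u\<in>star3. pfaffian u = 0" "\<forall>u\<in>plane3. pfaffian u = 0" "\<forall>u\<in>bent1 - {0}. pfaffian u = 1"
    unfolding normal_form_defs zero_prod_def by auto
  have "pfaffian (a + b, b, 0, 0, b, a) = 1" if "(a + b, b, 0, 0, b, a) \<noteq> 0" for a b
    using that by (cases a; cases b) (simp_all add: zero_prod_def)
  then show "\<forall>u\<in>bent2 - {0}. pfaffian u = 1" unfolding bent2_def by blast
qed

lemma admissible_normal_forms:
  "admissible 6 (code_of pencil1)" "admissible 7 (code_of pencil2)"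
  "admissible 8 (code_of star3)" "admissible 8 (code_of plane3)"
  "admissible 6 (code_of bent1)" "admissible 7 (code_of bent2)"
proof -
  have "U \<noteq> {0}" if "card U = 2 ^ Suc j" for U :: "form set" and j
  proof
    assume "U = {0}"
    then have "(2::nat) ^ Suc j = 1" using that by simp
    then show False by simp
  qed
  then have A: "admissible (5 + Suc j) (code_of U)"
    if "form_space U" "card U = 2 ^ Suc j" "(\<forall>a\<in>U. pfaffian a = 0) \<or> (\<forall>a\<in>U - {0}. pfaffian a = 1)"
    for U j using admissible_code_of that by blast
  note F = form_space_normal_forms and P = pfaffian_normal_forms and N = card_normal_forms
  show "admissible 6 (code_of pencil1)" using A[OF F(1), of 0] N(1) P(1) by simp
  show "admissible 7 (code_of pencil2)" using A[OF F(2), of 1] N(2) P(2) by (simp add: numeral_2_eq_2 One_nat_def)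
  show "admissible 8 (code_of star3)" using A[OF F(3), of 2] N(3) P(3) by simp
  show "admissible 8 (code_of plane3)" using A[OF F(4), of 2] N(4) P(4) by simp
  show "admissible 6 (code_of bent1)" using A[OF F(5), of 0] N(5) P(5) by simp
  show "admissible 7 (code_of bent2)" using A[OF F(6), of 1] N(6) P(6) by (simp add: numeral_2_eq_2 One_nat_def)
qed

section \<open>Invariants separating the normal forms\<close>

lemma weight_four_in_normal_forms:
  "U \<in> {pencil1, pencil2} \<Longrightarrow> 4 \<in> weight ` code_of U"
  "U \<in> {bent1, bent2} \<Longrightarrow> 4 \<notin> weight ` code_of U"
proof -
  assume "U \<in> {pencil1, pencil2}"
  then have "(1, 0, 0, 0, 0, 0) \<in> U" unfolding normal_form_defs by auto
  then show "4 \<in> weight ` code_of U"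
    unfolding weights_code_of[of U] using weights_code_of_canonical(2) by blast
next
  assume "U \<in> {bent1, bent2}"
  then have nz: "u = 0 \<or> pfaffian u = 1" if "u \<in> U" for u
    using that pfaffian_normal_forms(5,6) by blast
  have "4 \<notin> weight ` code_of {u}" if "u \<in> U" for u
    using nz[OF that] by (auto simp: weights_code_of_singleton simp del: pfaffian.simps)
  then show "4 \<notin> weight ` code_of U" unfolding weights_code_of[of U] by blast
qed

text \<open>Forms in \<^const>\<open>plane3\<close> do not involve the last variable, so shifting a position by 8 adds the
  coefficient of that variable; if it is 1, then the word is balanced and has weight 8.\<close>

lemma plane3_weight_four:
  assumes "v \<in> code_of plane3" "weight v = 4"
  shows "v $ 0 = v $ 8"
proof -
  obtain a b d c l where v: "v = quad_vec (a, b, 0, d, 0, 0) + affine_vec 4 c l"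
    using assms(1) unfolding code_of_def plane3_def reed_muller1_eq_affine by blast
  have shift: "v $ (i + 8) = v $ i + l 3" if "i < 8" for i
  proof -
    have "coord t (i + 8) = coord t i" if "t < 3" for t
      using coord_add_top[of i 3 t] that \<open>i < 8\<close> by simp
    moreover have "coord 3 (i + 8) = 1" "coord 3 i = 0"
      using coord_top[of i 3] coord_lt[of i 3] that by simp_all
    ultimately show ?thesis
      using that by (simp add: v quad_vec_def affine_vec_def sum_lessThan_4 add.assoc)
  qed
  have "l 3 = 0"
  proof (rule ccontr)
    assume "l 3 \<noteq> 0"
    then have l: "l 3 = 1" by simp
    have bint_one: "bint x + bint (x + 1) = 1" for x by (cases x) simp_all
    have "int (weight v) = (\<Sum>i<16. bint (v $ i))"
      using assms(1) code_of_carrier by (intro weight_eq_sum) blast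
    also have "\<dots> = (\<Sum>i<8. bint (v $ i) + bint (v $ (i + 8)))"
      by (simp add: eval_nat_numeral One_nat_def)
    also have "\<dots> = (\<Sum>i<(8::nat). 1)"
      using shift l bint_one by (intro sum.cong) simp_all
    finally show False using assms(2) by simp
  qed
  then show ?thesis using shift[of 0] by simp
qed

text \<open>The witnesses are the products \<open>(x\<^sub>0 + e) (x\<^sub>t + k)\<close>, which are supported on four points.\<close>

lemma star3_separates:
  assumes "i < 16" "j < 16" "i \<noteq> j"
  shows "\<exists>v\<in>code_of star3. weight v = 4 \<and> v $ i \<noteq> v $ j"
proof -
  note ev = sum_lessThan_16 sum_lessThan_4 coord_def bit_iff_odd
  obtain t where t: "t \<in> {1, 2, 3}" "coord 0 i \<noteq> coord 0 j \<or> coord t i \<noteq> coord t j"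
  proof -
    obtain s where s: "s < 4" "coord s i \<noteq> coord s j" using coord_separates[OF assms] by blast
    show ?thesis
    proof (cases "s = 0")
      case True
      then show ?thesis using s that[of 1] by simp
    next
      case False
      then have "s \<in> {1, 2, 3}" using s(1) by auto
      then show ?thesis using s that by blast
    qed
  qed
  \<comment> \<open>With these constants both factors are 1 at position \<open>i\<close>, and one of
    them vanishes at \<open>j\<close>. Expanding the product gives the coefficients in
    \<open>a\<close> and \<open>l\<close> and the constant \<open>e * k\<close>.\<close>
  define e k where "e = coord 0 i + 1" and "k = coord t i + 1"
  define a :: form where "a = (of_bool (t = 1), of_bool (t = 2), of_bool (t = 3), 0, 0, 0)"
  define l where "l s = (if s = 0 then k else if s = t then e else 0)" for s
  define v where "v = quad_vec a + affine_vec 4 (e * k) l"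
  have "v \<in> code_of star3"
    unfolding v_def a_def code_of_def star3_def using affine_vec_in_reed_muller1 by blast
  moreover have "int (weight v) = 4"
    unfolding v_def weight_quad_affine a_def l_def
    using t(1) by (elim insertE emptyE; cases e; cases k) (simp_all add: ev)
  moreover have val: "v $ m = (coord 0 m + e) * (coord t m + k)" if "m < 16" for m
    using that t(1) unfolding v_def quad_vec_def affine_vec_def a_def l_def
    by (elim insertE emptyE) (simp_all add: sum_lessThan_4 distrib_left distrib_right add_ac mult_ac)
  moreover have "v $ i = 1" unfolding val[OF assms(1)] e_def k_def by (simp flip: add.assoc)
  moreover have "v $ j = 0"
    unfolding val[OF assms(2)] e_def k_def using t(2)
    by (cases "coord 0 i"; cases "coord 0 j"; cases "coord t i"; cases "coord t j") simp_all
  ultimately show ?thesis by force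
qed

text \<open>An equivalence preserves weight 4, so the positions 0 and 8, which such words of
  \<open>code_of plane3\<close> never separate, would pull back to an unseparated pair for
  \<open>code_of star3\<close>.\<close>

lemma not_equivalent_star3_plane3: "\<not> code_equivalent 16 (code_of star3) (code_of plane3)"
proof
  assume "code_equivalent 16 (code_of star3) (code_of plane3)"
  then obtain p where p: "p permutes {..<16}" and eq: "code_of plane3 = permute_vec p ` code_of star3"
    unfolding code_equivalent_def by blast
  have "p 0 < 16" "p 8 < 16" using permutes_in_image[OF p] by force+
  moreover have "p 0 \<noteq> p 8" using permutes_inj[OF p] by (simp add: inj_eq)
  ultimately obtain v where v: "v \<in> code_of star3" "weight v = 4" "v $ p 0 \<noteq> v $ p 8"
    using star3_separates by blast
  have vc: "v \<in> carrier_vec 16" using v(1) code_of_carrier by blast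
  have "permute_vec p v $ 0 = permute_vec p v $ 8"
    using v(1,2) eq weight_permute_vec[OF vc p] by (intro plane3_weight_four) auto
  then show False using v(3) vc by (simp add: permute_vec_def)
qed

section \<open>Counting the equivalence classes\<close>

lemma admissible_normal_form:
  assumes "admissible k C"
  shows "\<exists>V\<in>{pencil1, pencil2, star3, plane3, bent1, bent2}. code_equivalent 16 C (code_of V)"
  using assms
proof (rule admissible_imp_form_space)
  fix U assume "form_space U" "C = code_of U" "U \<noteq> {0}"
    "(\<forall>u\<in>U. pfaffian u = 0) \<or> (\<forall>u\<in>U - {0}. pfaffian u = 1)"
  then show ?thesis
    using degenerate_normal_form[of U] nondegenerate_normal_form[of U] by blast
qed

lemma code_equivalent_card:
  assumes "code_equivalent n C D"
  shows "card C = card D"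
proof -
  have "card D \<le> card C" if "code_equivalent n C D" for C D
    using that finite_subset[OF _ finite_carrier_vec_bit] unfolding code_equivalent_def
    by (auto intro: card_image_le)
  then show ?thesis using assms code_equivalent_sym by (metis order_antisym)
qed

lemma admissible_dim_unique:
  assumes "admissible k C" "admissible m D" "code_equivalent 16 C D"
  shows "k = m"
proof -
  have "(2::nat) ^ k = 2 ^ m"
    using assms code_equivalent_card[OF assms(3)] by (simp add: admissible_def binary_code_iff)
  then show ?thesis by simp
qed

lemma card_quotient_two:
  assumes "equiv A r" "x \<in> A" "y \<in> A" "(x, y) \<notin> r" "\<And>z. z \<in> A \<Longrightarrow> (z, x) \<in> r \<or> (z, y) \<in> r"
  shows "card (A // r) = 2"
proof -
  have "A // r = {r `` {x}, r `` {y}}"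
  proof (intro equalityI subsetI)
    fix X assume "X \<in> A // r"
    then obtain z where "z \<in> A" "X = r `` {z}" by (rule quotientE)
    then show "X \<in> {r `` {x}, r `` {y}}" using assms(5)[of z] equiv_class_eq[OF assms(1)] by blast
  qed (use assms(2,3) in \<open>auto intro: quotientI\<close>)
  moreover have "r `` {x} \<noteq> r `` {y}" using assms(1,3,4) eq_equiv_class by metis
  ultimately show ?thesis by simp
qed

text \<open>Equivalent codes have equal size, so the normal form reached from an admissible code has
  the same dimension \<open>k\<close>; only the normal forms of that dimension represent
  classes.\<close>

lemma card_admissible_classes:
  assumes adm: "admissible k (code_of V)" "admissible k (code_of W)"
    and neq: "\<not> code_equivalent 16 (code_of V) (code_of W)"
    and nf: "\<And>X. X \<in> {pencil1, pencil2, star3, plane3, bent1, bent2} \<Longrightarrow> admissible k (code_of X) \<Longrightarrow> X = V \<or> X = W"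
  shows "card ({C. admissible k C} // admissible_equivalence k) = 2"
proof (rule card_quotient_two[OF equiv_admissible_equivalence])
  show "code_of V \<in> {C. admissible k C}" "code_of W \<in> {C. admissible k C}" using adm by auto
  show "(code_of V, code_of W) \<notin> admissible_equivalence k" using neq by (simp add: admissible_equivalence_def)
next
  fix C assume "C \<in> {C. admissible k C}"
  then have C: "admissible k C" by simp
  then obtain X where X: "X \<in> {pencil1, pencil2, star3, plane3, bent1, bent2}"
    and eq: "code_equivalent 16 C (code_of X)"
    using admissible_normal_form by blast
  have "\<exists>m. admissible m (code_of X)" using X admissible_normal_forms by blast
  then have "admissible k (code_of X)" using admissible_dim_unique[OF C _ eq] by blast
  then show "(C, code_of V) \<in> admissible_equivalence k \<or> (C, code_of W) \<in> admissible_equivalence k"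
    using nf[OF X] C eq by (auto simp: admissible_equivalence_def)
qed

theorem proposition4:
  shows "(\<forall>k. (\<exists>C. admissible k C) \<longrightarrow> k \<in> {6, 7, 8}) \<and>
    (\<forall>k \<in> {6, 7, 8}. card ({C. admissible k C} // admissible_equivalence k) = 2)"
proof -
  note nf = admissible_normal_forms
  have uniq: "k = m" if "admissible k C" "admissible m C" for k m C
    using that admissible_dim_unique[OF that] code_equivalent_refl[of C 16] binary_code_subset
    by (auto simp: admissible_def)
  have dims: "k \<in> {6, 7, 8}" if "admissible k C" for k C
    using admissible_normal_form[OF that] admissible_dim_unique[OF that] nf by blast
  have weights: "\<not> code_equivalent 16 (code_of V) (code_of W)"
    if "V \<in> {pencil1, pencil2}" "W \<in> {bent1, bent2}" for V W
    using weight_four_in_normal_forms(1)[OF that(1)] weight_four_in_normal_forms(2)[OF that(2)]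
      code_equivalent_weights[of 16 "code_of V" "code_of W"] by auto
  \<comment> \<open>Each normal form is admissible for one dimension only, which discards the normal
    forms of the other dimensions in the three counts.\<close>
  note distinct = uniq[OF nf(1)] uniq[OF nf(2)] uniq[OF nf(3)] uniq[OF nf(4)] uniq[OF nf(5)] uniq[OF nf(6)]
  have "card ({C. admissible 6 C} // admissible_equivalence 6) = 2"
    by (rule card_admissible_classes[OF nf(1,5) weights]) (auto dest: distinct)
  moreover have "card ({C. admissible 7 C} // admissible_equivalence 7) = 2"
    by (rule card_admissible_classes[OF nf(2,6) weights]) (auto dest: distinct)
  moreover have "card ({C. admissible 8 C} // admissible_equivalence 8) = 2"
    by (rule card_admissible_classes[OF nf(3,4) not_equivalent_star3_plane3]) (auto dest: distinct)
  ultimately show ?thesis using dims by blast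
qed

end
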